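(* Let $p\ge 1$ and let $\mathbf{R},\mathbf{S}\in\mathbb{R}^{p\times p}$ be covariance matrices (real symmetric positive-definite matrices). Then the Fisher-Rao distance $d(\mathbf{R},\mathbf{S})$ between $\mathbf{R}$ and $\mathbf{S}$ is given by $$d(\mathbf{R},\mathbf{S})^{2}=\frac{1}{2}\,\mathrm{tr}\left[\left(\log\left(\mathbf{R}^{-1/2}\mathbf{S}\mathbf{R}^{-1/2}\right)\right)^{2}\right].$$
   Context: Let $\mathcal{P}$ denote the set of $p\times p$ covariance matrices, i.e. the cone of real symmetric positive-definite $p\times p$ matrices. It carries its natural smooth structure as an embedded submanifold of $\mathbb{R}^{p^2}$ (an open subset of the space of real symmetric matrices); the tangent space at each $\mathbf{R}\in\mathcal{P}$ is the space of real symmetric $p\times p$ matrices. $\mathcal{P}$ is identified with the statistical model of zero-mean $p$-dimensional real Gaussians with densities (with respect to Lebesgue measure on $\mathbb{R}^p$) $$p(\mathbf{x};\mathbf{R})=\frac{1}{(2\pi)^{p/2}|\mathbf{R}|^{1/2}}\exp\left(-\tfrac12\mathbf{x}^\top\mathbf{R}^{-1}\mathbf{x}\right),\qquad \mathbf{R}\in\mathcal{P},$$ where $|\mathbf{R}|$ is the determinant. The Fisher information metric $g$ on $\mathcal{P}$ is the Riemannian metric defined, for tangent vectors (symmetric matrices) $\mathbf{A},\mathbf{B}$ at $\mathbf{R}$, by $$g_{\mathbf{R}}(\mathbf{A},\mathbf{B})=\int_{\mathbb{R}^p}\left.\frac{d}{dt}\right|_{t=0}\log p(\mathbf{x};\mathbf{R}+t\mathbf{A})\;\left.\frac{d}{dt}\right|_{t=0}\log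 p(\mathbf{x};\mathbf{R}+t\mathbf{B})\;p(\mathbf{x};\mathbf{R})\,d\mathbf{x}.$$ The Fisher-Rao distance $d(\mathbf{R},\mathbf{S})$ is the infimum of the lengths $\int_0^1\sqrt{g_{\gamma(t)}(\dot\gamma(t),\dot\gamma(t))}\,dt$ over all smooth paths $\gamma:[0,1]\to\mathcal{P}$ with $\gamma(0)=\mathbf{R}$ and $\gamma(1)=\mathbf{S}$. $\mathbf{R}^{-1/2}$ is the inverse of the positive-definite square root of $\mathbf{R}$, and $\log$ of a symmetric positive-definite matrix is its unique real symmetric logarithm. *)

theory Defs
  imports "HOL-Analysis.Analysis"
begin

text \<open>
  The dimension \<open>p\<close> is \<open>CARD('n)\<close>. Matrix products are written \<open>**\<close>: the operations
  \<open>*\<close> and \<open>^\<close> of the library act entrywise on matrices.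
\<close>

definition spd_matrices :: "(real ^ 'n ^ 'n) set" where
  "spd_matrices = {R. transpose R = R \<and> (\<forall>x. x \<noteq> 0 \<longrightarrow> 0 < x \<bullet> (R *v x))}"

definition gaussian_density :: "real ^ 'n ^ 'n \<Rightarrow> real ^ 'n \<Rightarrow> real" where
  "gaussian_density R x =
     1 / ((2 * pi) powr (real CARD('n) / 2) * sqrt (det R)) *
     exp (- (1 / 2) * (x \<bullet> (matrix_inv R *v x)))"

definition fisher_metric :: "real ^ 'n ^ 'n \<Rightarrow> real ^ 'n ^ 'n \<Rightarrow> real ^ 'n ^ 'n \<Rightarrow> real" where
  "fisher_metric R A B =
     (LINT x|lborel.
        deriv (\<lambda>t. ln (gaussian_density (R + t *\<^sub>R A) x)) 0 *
        deriv (\<lambda>t. ln (gaussian_density (R + t *\<^sub>R B) x)) 0 *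
        gaussian_density R x)"

text \<open>
  \<open>C\<^sup>\<infinity>\<close> on the closed unit interval, with one-sided derivatives at the end points;
  \<open>D k\<close> is the \<open>k\<close>-th derivative of the path.
\<close>

definition smooth_path :: "(real \<Rightarrow> 'a::real_normed_vector) \<Rightarrow> bool" where
  "smooth_path \<gamma> \<longleftrightarrow>
     (\<exists>D :: nat \<Rightarrow> real \<Rightarrow> 'a. D 0 = \<gamma> \<and>
        (\<forall>k. \<forall>t\<in>{0..1}. (D k has_vector_derivative D (Suc k) t) (at t within {0..1})))"

definition fisher_length :: "(real \<Rightarrow> real ^ 'n ^ 'n) \<Rightarrow> real" where
  "fisher_length \<gamma> =
     integral {0..1} (\<lambda>t. sqrt (fisher_metric (\<gamma> t)
       (vector_derivative \<gamma> (at t within {0..1}))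
       (vector_derivative \<gamma> (at t within {0..1}))))"

definition fisher_rao_dist :: "real ^ 'n ^ 'n \<Rightarrow> real ^ 'n ^ 'n \<Rightarrow> real" where
  "fisher_rao_dist R S =
     Inf {fisher_length \<gamma> | \<gamma>. smooth_path \<gamma> \<and> path_image \<gamma> \<subseteq> spd_matrices \<and>
                               pathstart \<gamma> = R \<and> pathfinish \<gamma> = S}"

definition spd_sqrt :: "real ^ 'n ^ 'n \<Rightarrow> real ^ 'n ^ 'n" where
  "spd_sqrt R = (THE Q. Q \<in> spd_matrices \<and> Q ** Q = R)"

definition matrix_exp :: "real ^ 'n ^ 'n \<Rightarrow> real ^ 'n ^ 'n" where
  "matrix_exp A = (\<Sum>k. (1 / fact k) *\<^sub>R (((**) A ^^ k) (mat 1)))"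

definition spd_log :: "real ^ 'n ^ 'n \<Rightarrow> real ^ 'n ^ 'n" where
  "spd_log R = (THE L. transpose L = L \<and> matrix_exp L = R)"

end

theory Submission
  imports Defs "HOL-Probability.Distributions"
begin

text \<open>
  Write \<open>R = M M\<^sup>T\<close> and \<open>S = M diag(e\<^sup>l) M\<^sup>T\<close> with \<open>M = R\<^sup>1\<^sup>/\<^sup>2 W\<close> and \<open>W\<close> orthogonal. Fourth moments of a
  standard Gaussian give \<open>g\<^sub>X(A, A) = tr (X\<^sup>-\<^sup>1 A X\<^sup>-\<^sup>1 A) / 2\<close>, so the path \<open>M diag(e\<^sup>t\<^sup>l) M\<^sup>T\<close> has length
  \<open>|l| / sqrt 2\<close>. No path is shorter: after a congruence it runs from \<open>1\<close> to \<open>diag(e\<^sup>l)\<close>, and along it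
  the Busemann function \<open>b = \<Sum>i. l\<^sub>i (ln \<Delta>\<^sub>i - ln \<Delta>\<^sub>i\<^sub>-\<^sub>1)\<close> of the leading principal minors \<open>\<Delta>\<^sub>i\<close> grows
  by \<open>|l|\<^sup>2\<close>, while its gradient for \<open>tr (X\<^sup>-\<^sup>1 A X\<^sup>-\<^sup>1 A)\<close> has norm exactly \<open>|l|\<close>.
\<close>

subsection \<open>The spectral theorem for symmetric matrices\<close>

text \<open>Eigenvalues of a moving matrix may fail to be differentiable where they cross, whereas
  logarithms of leading minors inherit the smoothness of every path of positive-definite matrices;
  this is why the lower bound uses minors. Their weighted sum \<open>b\<close> acts as a
  calibration: its increment depends on the end points only, and Cauchy-Schwarz bounds its
  derivative by \<open>|l|\<close> times the speed. The norm of the gradient is constant because the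
  X-orthogonal projections onto a coordinate flag have consecutive differences that are rank-one
  projections annihilating each other.

  Pointwise facts rest on one device: a positive-definite \<open>X\<close> and a symmetric
  \<open>A\<close> are simultaneously \<open>M M^T\<close> and \<open>M diag(l) M^T\<close>. For a
  point and a velocity this yields the metric, the derivative of \<open>ln det\<close> and the sign
  of the trace form; for \<open>R\<close> and \<open>S\<close> it normalizes the end points. The
  factor 1/2 of the theorem is 1/4 times 2: the derivative of the log density carries a factor 1/2,
  and \<open>y^2 - 1\<close> has variance 2 under a standard Gaussian.\<close>

lemma matrix_inv_eqI:
  fixes A B :: "'a::field ^ 'n ^ 'n"
  assumes "A ** B = mat 1"
  shows "matrix_inv A = B"
proof -
  have BA: "B ** A = mat 1"
    using assms matrix_left_right_inverse by blast
  have "A ** matrix_inv A = mat 1 \<and> matrix_inv A ** A = mat 1"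
    unfolding matrix_inv_def by (rule someI[of _ B]) (use assms BA in auto)
  then show ?thesis
    by (metis BA matrix_mul_assoc matrix_mul_lid matrix_mul_rid)
qed

lemma matrix_inv_left_right:
  fixes A :: "'a::field ^ 'n ^ 'n"
  assumes "invertible A"
  shows "A ** matrix_inv A = mat 1" "matrix_inv A ** A = mat 1"
proof -
  obtain B where B: "A ** B = mat 1" "B ** A = mat 1"
    using assms unfolding invertible_def by blast
  then show "A ** matrix_inv A = mat 1" "matrix_inv A ** A = mat 1"
    using matrix_inv_eqI[OF B(1)] by simp_all
qed

definition diag_matrix :: "('n \<Rightarrow> real) \<Rightarrow> real ^ 'n ^ 'n" where
  "diag_matrix d = (\<chi> i j. if i = j then d i else 0)"

lemma diag_matrix_mult_left: "(diag_matrix d ** A) $ i $ j = d i * A $ i $ j"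
  by (simp add: diag_matrix_def matrix_matrix_mult_def if_distrib[of "\<lambda>x. x * _"] cong: if_cong)

lemma diag_matrix_mult_right: "(A ** diag_matrix d) $ i $ j = A $ i $ j * d j"
  by (simp add: diag_matrix_def matrix_matrix_mult_def if_distrib[of "\<lambda>x. _ * x"] cong: if_cong)

lemma diag_matrix_mult: "diag_matrix a ** diag_matrix b = diag_matrix (\<lambda>i. a i * b i)"
  by (simp add: vec_eq_iff diag_matrix_mult_left) (simp add: diag_matrix_def)

lemma diag_matrix_one: "diag_matrix (\<lambda>_. 1) = mat 1"
  by (simp add: diag_matrix_def mat_def vec_eq_iff)

lemma transpose_diag_matrix: "transpose (diag_matrix d) = diag_matrix d"
  by (simp add: diag_matrix_def transpose_def vec_eq_iff)

lemma diag_matrix_mult_vec: "(diag_matrix d *v x) $ i = d i * x $ i"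
  by (simp add: diag_matrix_def matrix_vector_mult_def if_distrib[of "\<lambda>x. x * _"] cong: if_cong)

lemma det_diag_matrix: "det (diag_matrix d) = prod d UNIV"
  by (simp add: det_diagonal diag_matrix_def)

lemma trace_diag_matrix: "trace (diag_matrix d) = sum d UNIV"
  by (simp add: trace_def diag_matrix_def)

lemma inner_symmetric_matrix:
  fixes A :: "real ^ 'n ^ 'n"
  assumes "transpose A = A"
  shows "x \<bullet> (A *v y) = (A *v x) \<bullet> y"
  by (metis assms dot_lmul_matrix transpose_matrix_vector)

text \<open>Rayleigh's principle: a maximizer \<open>x\<close> of the quadratic form on the unit
  sphere of \<open>V\<close> is an eigenvector. The form \<open>q\<close> is nonnegative on
  \<open>V\<close> and vanishes at \<open>x\<close>, so its first variation there is zero. Invariant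
  subspaces are allowed for the sake of the induction that follows.\<close>

lemma self_adjoint_eigenvector:
  fixes f :: "'a::euclidean_space \<Rightarrow> 'a"
  assumes f: "linear f" "\<And>x y. x \<bullet> f y = f x \<bullet> y"
    and V: "subspace V" "f ` V \<subseteq> V" "V \<noteq> {0}"
  obtains x c where "x \<in> V" "norm x = 1" "f x = c *\<^sub>R x"
proof -
  let ?S = "sphere 0 1 \<inter> V"
  obtain v where v: "v \<in> V" "v \<noteq> 0"
    using V subspace_0 by blast
  have "v /\<^sub>R norm v \<in> ?S"
    using v V by (simp add: subspace_scale)
  then have "?S \<noteq> {}" by blast
  moreover have "compact ?S"
    by (simp add: V(1) closed_subspace compact_Int_closed)
  moreover have "continuous_on ?S (\<lambda>x. x \<bullet> f x)"
    by (intro continuous_intros linear_continuous_on linear_linear[THEN iffD2] f)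
  ultimately obtain x where x: "x \<in> ?S" and max: "\<And>y. y \<in> ?S \<Longrightarrow> y \<bullet> f y \<le> x \<bullet> f x"
    using continuous_attains_sup[of ?S "\<lambda>x. x \<bullet> f x"] by metis
  define m where "m = x \<bullet> f x"
  define q where "q y = m * (y \<bullet> y) - y \<bullet> f y" for y
  have q_nonneg: "0 \<le> q y" if "y \<in> V" for y
  proof (cases "y = 0")
    case False
    then have "y /\<^sub>R norm y \<in> ?S"
      using that V by (simp add: subspace_scale)
    from max[OF this] have "(y \<bullet> f y) / (norm y * norm y) \<le> m"
      by (simp add: m_def linear_scale[OF f(1)] divide_inverse mult_ac)
    then show ?thesis
      using False by (simp add: q_def divide_le_eq dot_square_norm power2_eq_square)
  qed (simp add: q_def)
  \<comment> \<open>Half the gradient of \<open>q\<close> at \<open>x\<close>; moving along it must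
    not make \<open>q\<close> negative, which forces \<open>w = 0\<close>.\<close>
  define w where "w = m *\<^sub>R x - f x"
  have w: "w \<in> V"
    using x V by (auto simp: w_def intro!: subspace_diff subspace_scale)
  have qx: "q x = 0"
    using x by (simp add: q_def m_def dot_square_norm)
  have quad: "0 \<le> 2 * t * (w \<bullet> w) + t\<^sup>2 * q w" for t
  proof -
    have "x + t *\<^sub>R w \<in> V"
      using x w V by (auto intro!: subspace_add subspace_scale)
    moreover have "q (x + t *\<^sub>R w) = q x + 2 * t * (w \<bullet> w) + t\<^sup>2 * q w"
    proof -
      have ww: "w \<bullet> w = m * (x \<bullet> w) - f x \<bullet> w"
        by (subst (1) w_def) (simp add: inner_diff_left)
      have "w \<bullet> f x = f x \<bullet> w" "x \<bullet> f w = f x \<bullet> w" "w \<bullet> x = x \<bullet> w"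
        using f(2)[of x w] by (simp_all add: inner_commute)
      then show ?thesis
        unfolding ww
        by (simp add: q_def linear_add[OF f(1)] linear_scale[OF f(1)] inner_add_left inner_add_right
            power2_eq_square algebra_simps)
    qed
    ultimately show ?thesis
      using q_nonneg[of "x + t *\<^sub>R w"] qx by simp
  qed
  have "w \<bullet> w = 0"
  proof (rule ccontr)
    assume "w \<bullet> w \<noteq> 0"
    then have ww: "0 < w \<bullet> w" by simp
    \<comment> \<open>A negative \<open>t\<close> small enough for the linear term to beat the
      quadratic one; the \<open>+ 1\<close> keeps the denominator positive when
      \<open>q w = 0\<close>.\<close>
    define t where "t = - (w \<bullet> w) / (q w + 1)"
    have qw: "0 \<le> q w" by (rule q_nonneg[OF w])
    have "t * (q w + 1) = - (w \<bullet> w)"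
      using qw by (simp add: t_def)
    then have "t * q w = - (w \<bullet> w) - t"
      by (simp add: algebra_simps)
    have "2 * t * (w \<bullet> w) + t\<^sup>2 * q w = t * (2 * (w \<bullet> w) + t * q w)"
      by (simp add: power2_eq_square algebra_simps)
    also have "\<dots> = t * (w \<bullet> w - t)"
      using \<open>t * q w = - (w \<bullet> w) - t\<close> by simp
    finally have "2 * t * (w \<bullet> w) + t\<^sup>2 * q w = t * (w \<bullet> w - t)" .
    moreover have "t < 0"
      using qw ww by (simp add: t_def divide_neg_pos)
    then have "t * (w \<bullet> w - t) < 0"
      using ww by (intro mult_neg_pos) linarith+
    ultimately show False
      using quad[of t] by simp
  qed
  then have "f x = m *\<^sub>R x"
    by (simp add: w_def)
  then show thesis
    using that x by auto
qed

text \<open>Induction on the dimension: split off one eigenvector \<open>x\<close>. Since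
  \<open>x \<bullet> f v\<close> is a multiple of \<open>x \<bullet> v\<close>, the complement of
  \<open>x\<close> in \<open>V\<close> is again invariant.\<close>

lemma self_adjoint_eigenbasis:
  fixes f :: "'a::euclidean_space \<Rightarrow> 'a"
  assumes f: "linear f" "\<And>x y. x \<bullet> f y = f x \<bullet> y"
    and V: "subspace V" "f ` V \<subseteq> V"
  shows "\<exists>B. pairwise orthogonal B \<and> span B = V \<and> (\<forall>x\<in>B. norm x = 1 \<and> (\<exists>c. f x = c *\<^sub>R x))"
  using V
proof (induction "dim V" arbitrary: V rule: less_induct)
  case less
  show ?case
  proof (cases "V = {0}")
    case True
    then show ?thesis
      by (intro exI[of _ "{}"]) auto
  next
    case False
    then obtain x c where x: "x \<in> V" "norm x = 1" "f x = c *\<^sub>R x"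
      using self_adjoint_eigenvector[OF f less.prems] by blast
    define U where "U = {v \<in> V. x \<bullet> v = 0}"
    have U: "subspace U"
      using less.prems(1) unfolding U_def subspace_def by (auto simp: inner_add_right)
    have fU: "f ` U \<subseteq> U"
      using less.prems(2) x by (auto simp: U_def f(2))
    have "x \<notin> U"
      using x by (auto simp: U_def)
    moreover have "U \<subseteq> V"
      by (auto simp: U_def)
    ultimately have "U \<subset> V"
      using x(1) by blast
    then have "dim U < dim V"
      using U less.prems(1) by (intro dim_psubset) (simp add: span_eq_iff[THEN iffD2])
    from less.hyps[OF this U fU] obtain B where B: "pairwise orthogonal B" "span B = U"
      "\<And>y. y \<in> B \<Longrightarrow> norm y = 1 \<and> (\<exists>c. f y = c *\<^sub>R y)" by blast
    have BU: "B \<subseteq> U"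
      using B(2) span_superset by blast
    have "pairwise orthogonal (insert x B)"
      using B(1) BU by (auto simp: pairwise_insert U_def orthogonal_def inner_commute)
    moreover have "span (insert x B) = V"
    proof
      have "insert x B \<subseteq> V"
        using x BU by (auto simp: U_def)
      then show "span (insert x B) \<subseteq> V"
        by (rule span_minimal) (rule less.prems(1))
      show "V \<subseteq> span (insert x B)"
      proof
        fix v assume v: "v \<in> V"
        have "v - (x \<bullet> v) *\<^sub>R x \<in> U"
          using v x less.prems(1)
          by (auto simp: U_def inner_diff_right dot_square_norm intro!: subspace_diff subspace_scale)
        then show "v \<in> span (insert x B)"
          using B(2) by (auto simp: span_insert)
      qed
    qed
    ultimately show ?thesis
      using x B(3) by (intro exI[of _ "insert x B"]) auto
  qed
qed

theorem symmetric_matrix_spectral: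
  fixes A :: "real ^ 'n ^ 'n"
  assumes "transpose A = A"
  obtains Q l where "orthogonal_matrix Q" "A = Q ** diag_matrix l ** transpose Q"
proof -
  obtain B where B: "pairwise orthogonal B" "span B = UNIV"
    "\<And>x. x \<in> B \<Longrightarrow> norm x = 1 \<and> (\<exists>c. A *v x = c *\<^sub>R x)"
    using self_adjoint_eigenbasis[of "(*v) A" UNIV, OF _ inner_symmetric_matrix[OF assms]]
    by (metis matrix_vector_mul_linear subspace_UNIV subset_UNIV)
  have "0 \<notin> B"
    using B(3) by force
  then have ind: "independent B"
    using B(1) pairwise_orthogonal_independent by blast
  then have "card B = CARD('n)"
    using B(2) dim_eq_card[of B "UNIV :: (real ^ 'n) set"] by (simp add: span_UNIV)
  moreover have "finite B"
    using ind independent_imp_finite by blast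
  \<comment> \<open>The eigenbasis has exactly \<open>CARD('n)\<close> elements, so the index type
    itself can number it and its members become the columns of \<open>Q\<close>.\<close>
  ultimately obtain e where e: "bij_betw e (UNIV :: 'n set) B"
    using finite_same_card_bij[of "UNIV :: 'n set" B] by auto
  have eB: "e i \<in> B" for i
    using e by (auto simp: bij_betw_def)
  then have "\<exists>c. A *v e i = c *\<^sub>R e i" for i
    using B(3) by blast
  then obtain l where l: "\<And>i. A *v e i = l i *\<^sub>R e i"
    by metis
  define Q where "Q = (\<chi> i j. e j $ i)"
  have col: "column j Q = e j" for j
    by (simp add: Q_def column_def vec_eq_iff)
  have orth: "orthogonal_matrix Q"
    unfolding orthogonal_matrix_orthonormal_columns col
  proof (intro conjI allI impI)
    show "norm (e i) = 1" for i
      using B(3) eB by blast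
    show "orthogonal (e i) (e j)" if "i \<noteq> j" for i j
      using B(1) eB e that unfolding pairwise_def bij_betw_def by (metis UNIV_I inj_eq)
  qed
  have "A ** Q = Q ** diag_matrix l"
  proof -
    have "(A ** Q) $ i $ j = (Q ** diag_matrix l) $ i $ j" for i j
    proof -
      have "(A ** Q) $ i $ j = (A *v e j) $ i"
        by (simp add: matrix_matrix_mult_def matrix_vector_mult_def Q_def)
      then show ?thesis
        by (simp add: l diag_matrix_mult_right Q_def mult.commute)
    qed
    then show ?thesis by (simp add: vec_eq_iff)
  qed
  then have "A = Q ** diag_matrix l ** transpose Q"
    using orth by (metis matrix_mul_assoc matrix_mul_rid orthogonal_matrix_def)
  with orth show thesis by (rule that)
qed

subsection \<open>Square roots and logarithms of positive-definite matrices\<close>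

lemma orthogonal_matrix_transpose_mult:
  fixes Q :: "real ^ 'n ^ 'n"
  assumes "orthogonal_matrix Q"
  shows "transpose Q ** Q = mat 1" "Q ** transpose Q = mat 1"
  using assms by (simp_all add: orthogonal_matrix_def)

lemma matrix_mult_cancel_left:
  fixes A B X :: "real ^ 'n ^ 'n"
  assumes "A ** B = mat 1"
  shows "A ** (B ** X) = X"
  using assms by (simp add: matrix_mul_assoc)

lemma spd_congruence:
  fixes M X :: "real ^ 'n ^ 'n"
  assumes "X \<in> spd_matrices" and "invertible M"
  shows "M ** X ** transpose M \<in> spd_matrices"
proof -
  have "transpose (M ** X ** transpose M) = M ** X ** transpose M"
    using assms(1) by (simp add: spd_matrices_def matrix_transpose_mul matrix_mul_assoc)
  moreover have "0 < x \<bullet> ((M ** X ** transpose M) *v x)" if "x \<noteq> 0" for x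
  proof -
    have "invertible (transpose M)"
      by (simp add: assms(2) transpose_invertible)
    then have "transpose M *v x \<noteq> 0"
      using that inj_matrix_vector_mult[of "transpose M"]
      by (metis inj_eq matrix_vector_mult_0_right)
    then have "0 < (transpose M *v x) \<bullet> (X *v (transpose M *v x))"
      using assms(1) by (simp add: spd_matrices_def)
    also have "\<dots> = x \<bullet> (M *v (X *v (transpose M *v x)))"
      by (metis dot_lmul_matrix transpose_matrix_vector)
    finally show ?thesis
      by (simp only: matrix_vector_mul_assoc matrix_mul_assoc)
  qed
  ultimately show ?thesis
    by (simp add: spd_matrices_def)
qed

lemma diag_matrix_spd_iff: "diag_matrix d \<in> spd_matrices \<longleftrightarrow> (\<forall>i. 0 < d i)"
proof
  assume d: "diag_matrix d \<in> spd_matrices"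
  show "\<forall>i. 0 < d i"
  proof
    fix i
    have "0 < axis i 1 \<bullet> (diag_matrix d *v axis i 1)"
      using d by (simp add: spd_matrices_def axis_eq_0_iff)
    also have "\<dots> = d i"
      by (simp add: inner_axis' diag_matrix_mult_vec)
    finally show "0 < d i" .
  qed
next
  assume d: "\<forall>i. 0 < d i"
  have "0 < x \<bullet> (diag_matrix d *v x)" if x: "x \<noteq> 0" for x
  proof -
    obtain i where "x $ i \<noteq> 0"
      using x by (auto simp: vec_eq_iff)
    then have "0 < (\<Sum>i\<in>UNIV. d i * (x $ i)\<^sup>2)"
      using d by (intro sum_pos2[of _ i]) (auto simp: less_imp_le)
    then show ?thesis
      by (simp add: inner_vec_def diag_matrix_mult_vec power2_eq_square mult_ac)
  qed
  then show "diag_matrix d \<in> spd_matrices"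
    by (simp add: spd_matrices_def transpose_diag_matrix)
qed

lemma spd_spectral:
  fixes R :: "real ^ 'n ^ 'n"
  assumes "R \<in> spd_matrices"
  obtains Q d where "orthogonal_matrix Q" "\<And>i. 0 < d i" "R = Q ** diag_matrix d ** transpose Q"
proof -
  obtain Q d where Q: "orthogonal_matrix Q" and R: "R = Q ** diag_matrix d ** transpose Q"
    using symmetric_matrix_spectral assms unfolding spd_matrices_def by blast
  have "transpose Q ** R ** Q = diag_matrix d"
    using orthogonal_matrix_transpose_mult[OF Q]
    by (simp add: R matrix_mul_assoc[symmetric] matrix_mult_cancel_left)
  moreover have "invertible (transpose Q)"
    using orthogonal_matrix_transpose_mult[OF Q] by (auto simp: invertible_def)
  then have "transpose Q ** R ** transpose (transpose Q) \<in> spd_matrices"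
    by (rule spd_congruence[OF assms])
  ultimately have "\<forall>i. 0 < d i"
    by (simp add: diag_matrix_spd_iff)
  then show thesis
    using that Q R by blast
qed

lemma orthogonal_diag_spd:
  fixes Q :: "real ^ 'n ^ 'n"
  assumes "orthogonal_matrix Q" "\<And>i. 0 < d i"
  shows "Q ** diag_matrix d ** transpose Q \<in> spd_matrices"
proof (rule spd_congruence)
  show "invertible Q"
    using orthogonal_matrix_transpose_mult[OF assms(1)] by (auto simp: invertible_def)
qed (simp add: diag_matrix_spd_iff assms)

lemma spd_det_pos:
  fixes R :: "real ^ 'n ^ 'n"
  assumes "R \<in> spd_matrices"
  shows "0 < det R"
proof -
  obtain Q d where Q: "orthogonal_matrix Q" and d: "\<And>i. 0 < d i"
    and R: "R = Q ** diag_matrix d ** transpose Q"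
    using spd_spectral[OF assms] by blast
  have "det Q * det Q = 1"
    using orthogonal_matrix_transpose_mult[OF Q] by (metis det_I det_mul det_transpose)
  then have "det R = prod d UNIV"
    by (simp add: R det_mul det_transpose det_diag_matrix)
  then show ?thesis
    by (simp add: d prod_pos)
qed

lemma spd_invertible:
  fixes R :: "real ^ 'n ^ 'n"
  assumes "R \<in> spd_matrices"
  shows "invertible R"
  using spd_det_pos[OF assms] by (simp add: invertible_det_nz)

lemma spd_transpose: "R \<in> spd_matrices \<Longrightarrow> transpose R = R"
  by (simp add: spd_matrices_def)

text \<open>The common source of uniqueness for square roots and logarithms.
  \<open>W = Q^T P\<close> intertwines the two diagonal matrices of \<open>f\<close>-values, so an
  entry \<open>W $ i $ j\<close> can be nonzero only where \<open>f (a i) = f (b j)\<close>; there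
  \<open>a i = b j\<close>, hence \<open>W\<close> intertwines \<open>a\<close> and \<open>b\<close>
  as well. Injectivity is asked only for the values that occur, because squaring is injective only
  on the positive half-line.\<close>

lemma orthogonal_diag_eq_imp:
  fixes Q P :: "real ^ 'n ^ 'n"
  assumes Q: "orthogonal_matrix Q" and P: "orthogonal_matrix P"
    and eq: "Q ** diag_matrix (\<lambda>i. f (a i)) ** transpose Q = P ** diag_matrix (\<lambda>i. f (b i)) ** transpose P"
    and inj: "\<And>i j. f (a i) = f (b j) \<Longrightarrow> a i = b j"
  shows "Q ** diag_matrix a ** transpose Q = P ** diag_matrix b ** transpose P"
proof -
  note o = orthogonal_matrix_transpose_mult[OF Q] orthogonal_matrix_transpose_mult[OF P]
  define W where "W = transpose Q ** P"
  have "diag_matrix (\<lambda>i. f (a i)) ** W = transpose Q ** (Q ** diag_matrix (\<lambda>i. f (a i)) ** transpose Q) ** P"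
    by (simp add: W_def matrix_mul_assoc[symmetric] matrix_mult_cancel_left[OF o(1)])
  also have "\<dots> = W ** diag_matrix (\<lambda>i. f (b i))"
    by (simp only: eq) (simp add: W_def matrix_mul_assoc[symmetric] o)
  finally have "f (a i) * W $ i $ j = W $ i $ j * f (b j)" for i j
    by (metis diag_matrix_mult_left diag_matrix_mult_right)
  then have "a i * W $ i $ j = W $ i $ j * b j" for i j
    using inj[of i j] by (metis mult.commute mult_cancel_right)
  then have W: "diag_matrix a ** W = W ** diag_matrix b"
    by (simp add: vec_eq_iff diag_matrix_mult_left diag_matrix_mult_right)
  have "Q ** diag_matrix a ** transpose Q = Q ** (diag_matrix a ** W) ** transpose P"
    by (simp add: W_def matrix_mul_assoc[symmetric] o)
  also have "\<dots> = P ** diag_matrix b ** transpose P"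
    by (simp only: W) (simp add: W_def matrix_mul_assoc o)
  finally show ?thesis .
qed

lemma orthogonal_diag_mult:
  fixes Q :: "real ^ 'n ^ 'n"
  assumes "orthogonal_matrix Q"
  shows "(Q ** diag_matrix a ** transpose Q) ** (Q ** diag_matrix b ** transpose Q)
    = Q ** diag_matrix (\<lambda>i. a i * b i) ** transpose Q"
  using orthogonal_matrix_transpose_mult[OF assms]
  by (simp add: matrix_mul_assoc[symmetric] matrix_mult_cancel_left)
    (simp add: matrix_mul_assoc diag_matrix_mult)

lemma spd_sqrt_diag:
  fixes Q :: "real ^ 'n ^ 'n"
  assumes Q: "orthogonal_matrix Q" and d: "\<And>i. 0 < d i"
  shows "spd_sqrt (Q ** diag_matrix d ** transpose Q) = Q ** diag_matrix (\<lambda>i. sqrt (d i)) ** transpose Q"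
  unfolding spd_sqrt_def
proof (rule the_equality, intro conjI)
  show "Q ** diag_matrix (\<lambda>i. sqrt (d i)) ** transpose Q \<in> spd_matrices"
    by (simp add: orthogonal_diag_spd Q d)
  show "(Q ** diag_matrix (\<lambda>i. sqrt (d i)) ** transpose Q) ** (Q ** diag_matrix (\<lambda>i. sqrt (d i)) ** transpose Q)
    = Q ** diag_matrix d ** transpose Q"
    using d by (simp add: orthogonal_diag_mult[OF Q] less_imp_le)
next
  fix X assume X: "X \<in> spd_matrices \<and> X ** X = Q ** diag_matrix d ** transpose Q"
  then obtain P e where P: "orthogonal_matrix P" and e: "\<And>i. 0 < e i"
    and Xe: "X = P ** diag_matrix e ** transpose P"
    using spd_spectral by metis
  \<comment> \<open>Both sides are put into the form of \<open>f\<close>-values with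
    \<open>f\<close> the square, so that the uniqueness lemma applies to \<open>e\<close> and
    \<open>sqrt (d i)\<close>.\<close>
  have "P ** diag_matrix (\<lambda>i. (e i)\<^sup>2) ** transpose P = Q ** diag_matrix (\<lambda>i. (sqrt (d i))\<^sup>2) ** transpose Q"
    using X d by (simp add: Xe orthogonal_diag_mult[OF P] power2_eq_square less_imp_le)
  moreover have "e i = sqrt (d j)" if "(e i)\<^sup>2 = (sqrt (d j))\<^sup>2" for i j
    using that e[of i] d[of j] by (simp add: less_imp_le real_sqrt_unique)
  ultimately show "X = Q ** diag_matrix (\<lambda>i. sqrt (d i)) ** transpose Q"
    unfolding Xe by (rule orthogonal_diag_eq_imp[where f = "\<lambda>x. x\<^sup>2", OF P Q])
qed

lemma
  fixes R :: "real ^ 'n ^ 'n"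
  assumes "R \<in> spd_matrices"
  shows spd_sqrt_spd: "spd_sqrt R \<in> spd_matrices"
    and spd_sqrt_square: "spd_sqrt R ** spd_sqrt R = R"
proof -
  obtain Q d where Q: "orthogonal_matrix Q" and d: "\<And>i. 0 < d i"
    and R: "R = Q ** diag_matrix d ** transpose Q"
    using spd_spectral[OF assms] by blast
  show "spd_sqrt R \<in> spd_matrices"
    by (simp add: R spd_sqrt_diag[OF Q d] orthogonal_diag_spd Q d)
  show "spd_sqrt R ** spd_sqrt R = R"
    using d by (simp add: R spd_sqrt_diag[OF Q d] orthogonal_diag_mult[OF Q] less_imp_le)
qed

text \<open>Each entry is linear in \<open>d\<close>; convergence of the exponential series and the
  formula for straight lines thereby reduce to scalars.\<close>

lemma matrix_diag_conj_nth:
  "(M ** diag_matrix d ** transpose M) $ i $ j = (\<Sum>k\<in>UNIV. M $ i $ k * M $ j $ k * d k)"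
proof -
  have "(M ** diag_matrix d ** transpose M) $ i $ j
      = (\<Sum>k\<in>UNIV. (M ** diag_matrix d) $ i $ k * transpose M $ k $ j)"
    by (subst matrix_matrix_mult_def) simp
  then show ?thesis
    by (simp add: diag_matrix_mult_right transpose_def mult_ac)
qed

lemma matrix_exp_diag:
  fixes Q :: "real ^ 'n ^ 'n"
  assumes Q: "orthogonal_matrix Q"
  shows "matrix_exp (Q ** diag_matrix l ** transpose Q) = Q ** diag_matrix (\<lambda>i. exp (l i)) ** transpose Q"
proof -
  let ?C = "\<lambda>d. Q ** diag_matrix d ** transpose Q"
  have pow: "(((**) (?C l)) ^^ k) (mat 1) = ?C (\<lambda>i. l i ^ k)" for k
  proof (induction k)
    case 0
    then show ?case
      by (simp add: diag_matrix_one orthogonal_matrix_transpose_mult[OF Q])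
  next
    case (Suc k)
    then show ?case
      by (simp add: orthogonal_diag_mult[OF Q])
  qed
  have "(\<lambda>k. (1 / fact k) *\<^sub>R ?C (\<lambda>i. l i ^ k)) sums ?C (\<lambda>i. exp (l i))"
    unfolding sums_def
  proof (intro vec_tendstoI)
    fix i j
    have "(\<lambda>k. (1 / fact k) * ?C (\<lambda>i. l i ^ k) $ i $ j) sums (?C (\<lambda>i. exp (l i)) $ i $ j)"
    proof -
      have "(\<lambda>k. \<Sum>m\<in>UNIV. Q $ i $ m * Q $ j $ m * (l m ^ k /\<^sub>R fact k)) sums
          (\<Sum>m\<in>UNIV. Q $ i $ m * Q $ j $ m * exp (l m))"
        by (intro sums_sum sums_mult exp_converges)
      then show ?thesis
        unfolding matrix_diag_conj_nth by (simp add: sum_distrib_left divide_inverse mult_ac)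
    qed
    then show "(\<lambda>n. (\<Sum>k<n. (1 / fact k) *\<^sub>R ?C (\<lambda>i. l i ^ k)) $ i $ j)
        \<longlonglongrightarrow> ?C (\<lambda>i. exp (l i)) $ i $ j"
      unfolding sums_def by (simp add: sum_component)
  qed
  then show ?thesis
    unfolding matrix_exp_def pow by (rule sums_unique[symmetric])
qed

lemma spd_log_diag:
  fixes Q :: "real ^ 'n ^ 'n"
  assumes Q: "orthogonal_matrix Q"
  shows "spd_log (Q ** diag_matrix (\<lambda>i. exp (l i)) ** transpose Q) = Q ** diag_matrix l ** transpose Q"
  unfolding spd_log_def
proof (rule the_equality, intro conjI)
  show "transpose (Q ** diag_matrix l ** transpose Q) = Q ** diag_matrix l ** transpose Q"
    by (simp add: matrix_transpose_mul transpose_diag_matrix matrix_mul_assoc)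
  show "matrix_exp (Q ** diag_matrix l ** transpose Q) = Q ** diag_matrix (\<lambda>i. exp (l i)) ** transpose Q"
    by (rule matrix_exp_diag[OF Q])
next
  fix X assume X: "transpose X = X \<and> matrix_exp X = Q ** diag_matrix (\<lambda>i. exp (l i)) ** transpose Q"
  then obtain P e where P: "orthogonal_matrix P" and Xe: "X = P ** diag_matrix e ** transpose P"
    using symmetric_matrix_spectral by metis
  have "P ** diag_matrix (\<lambda>i. exp (e i)) ** transpose P = Q ** diag_matrix (\<lambda>i. exp (l i)) ** transpose Q"
    using X by (simp add: Xe matrix_exp_diag[OF P])
  from orthogonal_diag_eq_imp[where f = exp, OF P Q this] show "X = Q ** diag_matrix l ** transpose Q"
    by (simp add: Xe)
qed

text \<open>Diagonalize \<open>H^-1 A H^-1 = W diag(l) W^T\<close> for \<open>H = spd_sqrt R\<close>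
  and multiply back by \<open>H\<close>. The factor is kept in the form \<open>H W\<close> because
  integrals transform simply under a positive-definite and an orthogonal map, and because stripping
  \<open>H\<close> from it produces the matrix whose logarithm the theorem takes.\<close>

lemma simultaneous_diagonalization:
  fixes R A :: "real ^ 'n ^ 'n"
  assumes R: "R \<in> spd_matrices" and A: "transpose A = A"
  obtains W l where "orthogonal_matrix W"
    "R = (spd_sqrt R ** W) ** transpose (spd_sqrt R ** W)"
    "A = (spd_sqrt R ** W) ** diag_matrix l ** transpose (spd_sqrt R ** W)"
proof -
  define H where "H = spd_sqrt R"
  define K where "K = matrix_inv H"
  have H: "H \<in> spd_matrices" "H ** H = R"
    by (simp_all add: H_def spd_sqrt_spd spd_sqrt_square R)
  note HT = spd_transpose[OF H(1)]
  have HK: "H ** K = mat 1" "K ** H = mat 1"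
    using matrix_inv_left_right[OF spd_invertible[OF H(1)]] by (simp_all add: K_def)
  have KT: "transpose K = K"
    by (metis HK(1) HT K_def matrix_inv_eqI matrix_left_right_inverse matrix_transpose_mul transpose_mat)
  have "transpose (K ** A ** K) = K ** A ** K"
    by (simp add: matrix_transpose_mul A KT matrix_mul_assoc)
  then obtain W l where W: "orthogonal_matrix W" and B: "K ** A ** K = W ** diag_matrix l ** transpose W"
    using symmetric_matrix_spectral by metis
  have "(H ** W) ** transpose (H ** W) = R"
    using H(2) by (simp add: matrix_transpose_mul HT matrix_mul_assoc[symmetric]
        matrix_mult_cancel_left[OF orthogonal_matrix_transpose_mult(2)[OF W]])
  moreover have "A = H ** (K ** A ** K) ** H"
    by (simp add: matrix_mul_assoc[symmetric] matrix_mult_cancel_left[OF HK(1)] HK)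
  then have "A = (H ** W) ** diag_matrix l ** transpose (H ** W)"
    unfolding B by (simp add: matrix_transpose_mul HT matrix_mul_assoc)
  ultimately show thesis
    using that W unfolding H_def by metis
qed

subsection \<open>Linear changes of variables for Lebesgue measure\<close>

text \<open>
  The linear change of variables of the library needs a well-ordered index type. Here Vitali's
  theorem fills a box with disjoint balls up to a null set, and isometries preserve the volume of
  balls.
\<close>

lemma distr_lborel_orthogonal_transformation:
  fixes f :: "'a::euclidean_space \<Rightarrow> 'a"
  assumes f: "orthogonal_transformation f"
  shows "distr lborel borel f = lborel"
proof (rule lborel_eqI[symmetric])
  define g where "g = inv f"
  have g: "orthogonal_transformation g"
    unfolding g_def by (rule orthogonal_transformation_inv[OF f])
  have vimage: "f -` A = g ` A" for A
    unfolding g_def using orthogonal_transformation_bij[OF f] by (rule bij_vimage_eq_inv_image)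
  have fm: "f \<in> borel_measurable borel"
    using orthogonal_transformation_linear[OF f]
    by (intro borel_measurable_continuous_onI linear_continuous_on) (simp add: linear_linear)
  let ?N = "distr lborel borel f"
  have emeasure_f: "emeasure ?N A = emeasure lborel (g ` A)" if "A \<in> sets borel" for A
    using that fm by (simp add: emeasure_distr vimage)
  have balls: "emeasure ?N (ball a r) = emeasure lborel (ball a r)" for a r
  proof (cases "0 \<le> r")
    case True
    then show ?thesis
      by (simp add: emeasure_f image_orthogonal_transformation_ball[OF g] emeasure_ball)
  next
    case False
    then show ?thesis by (simp add: ball_empty)
  qed
  \<comment> \<open>Needed for the part of a box that the disjoint balls miss: a linear map sends
    null sets to null sets.\<close>
  have null: "emeasure ?N A = 0" if A: "A \<in> sets borel" "negligible A" for A
  proof -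
    have "negligible (g ` A)"
      using A(2) orthogonal_transformation_linear[OF g]
      by (intro negligible_differentiable_image_negligible) (auto simp: linear_imp_differentiable_on)
    moreover have "g ` A \<in> sets borel"
      using measurable_sets[OF fm A(1)] by (simp add: vimage)
    ultimately show ?thesis
      using A(1) by (simp add: emeasure_f negligible_iff_emeasure0)
  qed
  show "emeasure ?N (box l u) = (\<Prod>b\<in>Basis. (u - l) \<bullet> b)"
    if lu: "\<And>b. b \<in> Basis \<Longrightarrow> l \<bullet> b \<le> u \<bullet> b" for l u
  proof -
    \<comment> \<open>Admissible balls as pairs of centre and radius. The next step is Vitali's
      fineness condition: every point of the box lies in such balls of arbitrarily small
      radius.\<close>
    define K where "K = {(a, r). ball a r \<subseteq> box l u}"
    have "\<exists>i. i \<in> K \<and> x \<in> ball (fst i) (snd i) \<and> snd i < e" if x: "x \<in> box l u" and e: "0 < e" for x e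
    proof -
      obtain r where r: "0 < r" "ball x r \<subseteq> box l u"
        using open_box x openE by blast
      then have "(x, min r (e / 2)) \<in> K"
        using e unfolding K_def by (auto simp: subset_iff)
      then show ?thesis
        using r(1) e by (intro exI[of _ "(x, min r (e / 2))"]) auto
    qed
    then obtain C where C: "countable C" "C \<subseteq> K"
      "pairwise (\<lambda>i j. disjnt (ball (fst i) (snd i)) (ball (fst j) (snd j))) C"
      "negligible (box l u - (\<Union>i\<in>C. ball (fst i) (snd i)))"
      using Vitali_covering_theorem_balls[of "box l u" K fst snd] by blast
    define U where "U = (\<Union>i\<in>C. ball (fst i) (snd i))"
    have U: "open U" "U \<subseteq> box l u"
      using C(2) by (force simp: U_def K_def subset_iff)+
    have disj: "disjoint_family_on (\<lambda>i. ball (fst i) (snd i)) C"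
      using C(3) by (auto simp: disjoint_family_on_def pairwise_def disjnt_def)
    have "emeasure ?N U = (\<integral>\<^sup>+i. emeasure ?N (ball (fst i) (snd i)) \<partial>count_space C)"
      unfolding U_def by (rule emeasure_UN_countable[OF _ C(1) disj]) simp
    also have "\<dots> = (\<integral>\<^sup>+i. emeasure lborel (ball (fst i) (snd i)) \<partial>count_space C)"
      by (simp add: balls)
    also have "\<dots> = emeasure lborel U"
      unfolding U_def by (rule emeasure_UN_countable[OF _ C(1) disj, symmetric]) simp
    finally have eq_U: "emeasure ?N U = emeasure lborel U" .
    have split: "emeasure M (box l u) = emeasure M U"
      if "sets M = sets borel" "emeasure M (box l u - U) = 0" for M :: "'a measure"
    proof -
      have "emeasure M (U \<union> (box l u - U)) = emeasure M U"
        using that U by (intro emeasure_Un_null_set) (auto simp: null_sets_def)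
      moreover have "U \<union> (box l u - U) = box l u"
        using U by blast
      ultimately show ?thesis by simp
    qed
    have neg: "negligible (box l u - U)" "box l u - U \<in> sets borel"
      using C(4) U by (auto simp: U_def[symmetric])
    then have "emeasure lborel (box l u - U) = 0"
      by (simp add: negligible_iff_emeasure0)
    then have "emeasure ?N (box l u) = emeasure lborel (box l u)"
      using split[of ?N] split[of lborel] null[OF neg(2,1)] eq_U by simp
    also have "\<dots> = (\<Prod>b\<in>Basis. (u - l) \<bullet> b)"
      using lu by (simp add: emeasure_lborel_box_eq)
    finally show ?thesis .
  qed
qed simp

lemma borel_measurable_matrix_vector_mult [measurable]:
  fixes A :: "real ^ 'n ^ 'm"
  shows "(*v) A \<in> borel_measurable borel"
  by (intro borel_measurable_continuous_onI linear_continuous_on)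
    (simp add: linear_linear matrix_vector_mul_linear)

lemma lborel_integral_orthogonal_matrix:
  fixes Q :: "real ^ 'n ^ 'n" and g :: "real ^ 'n \<Rightarrow> real"
  assumes "orthogonal_matrix Q" and [measurable]: "g \<in> borel_measurable borel"
  shows "(LINT x|lborel. g (Q *v x)) = (LINT x|lborel. g x)"
proof -
  have "orthogonal_transformation ((*v) Q)"
    using assms(1) by (simp add: orthogonal_transformation_matrix matrix_vector_mul_linear)
  then have "(LINT x|lborel. g x) = (LINT x|distr lborel borel ((*v) Q). g x)"
    by (simp add: distr_lborel_orthogonal_transformation)
  also have "\<dots> = (LINT x|lborel. g (Q *v x))"
    by (subst integral_distr) auto
  finally show ?thesis ..
qed

lemma bij_betw_axis_Basis: "bij_betw (\<lambda>i. axis i (1::real)) UNIV (Basis :: (real ^ 'n) set)"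
  by (auto simp: bij_betw_def inj_on_def axis_eq_axis Basis_vec_def)

lemma sum_Basis_vec: "(\<Sum>b\<in>Basis. F (b :: real ^ 'n)) = (\<Sum>i\<in>UNIV. F (axis i 1))"
  using sum.reindex_bij_betw[OF bij_betw_axis_Basis, of F] by simp

lemma prod_Basis_vec: "(\<Prod>b\<in>Basis. F (b :: real ^ 'n)) = (\<Prod>i\<in>UNIV. F (axis i 1))"
  using prod.reindex_bij_betw[OF bij_betw_axis_Basis, of F] by simp

lemma lborel_integral_diag_matrix:
  fixes g :: "real ^ 'n \<Rightarrow> real"
  assumes d: "\<And>i. 0 < d i" and [measurable]: "g \<in> borel_measurable borel"
  shows "(LINT x|lborel. g x) = prod d UNIV * (LINT x|lborel. g (diag_matrix d *v x))"
proof -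
  \<comment> \<open>The scaling theorem indexes its factors by basis vectors; \<open>c\<close>
    transports \<open>d\<close> from coordinates to them.\<close>
  define c where "c b = b \<bullet> (\<chi> i. d i)" for b :: "real ^ 'n"
  have c: "c (axis i 1) = d i" for i
    by (simp add: c_def inner_axis')
  have T: "0 + (\<Sum>j\<in>Basis. (c j * (x \<bullet> j)) *\<^sub>R j) = diag_matrix d *v x" for x
    unfolding sum_Basis_vec c
    by (simp add: vec_eq_iff diag_matrix_mult_vec inner_axis)
      (simp add: axis_def if_distrib cong: if_cong)
  have nz: "c j \<noteq> 0" if j: "j \<in> Basis" for j
  proof -
    obtain i where "j = axis i 1"
      using j by (auto simp: Basis_vec_def)
    then show ?thesis using d[of i] by (simp add: c)
  qed
  have "(\<Prod>j\<in>Basis. \<bar>c j\<bar>) = prod d UNIV"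
    using d by (simp add: prod_Basis_vec c less_imp_le)
  then have "lborel = density (distr lborel borel ((*v) (diag_matrix d))) (\<lambda>_. ennreal (prod d UNIV))"
    using lborel_affine_euclidean[of c 0, OF nz] unfolding T by simp
  then have "(LINT x|lborel. g x)
      = (LINT x|density (distr lborel borel ((*v) (diag_matrix d))) (\<lambda>_. ennreal (prod d UNIV)). g x)"
    by simp
  also have "\<dots> = (LINT x|distr lborel borel ((*v) (diag_matrix d)). prod d UNIV *\<^sub>R g x)"
    by (subst integral_density) (auto simp: d prod_nonneg less_imp_le)
  also have "\<dots> = prod d UNIV * (LINT x|lborel. g (diag_matrix d *v x))"
    by (subst integral_distr) auto
  finally show ?thesis .
qed

text \<open>With \<open>H = Q diag(d) Q^T\<close>, the map \<open>H W\<close> is a rotation, a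
  coordinate scaling and another rotation \<open>Q^T W\<close>; only the scaling changes volume, by
  \<open>prod d = det H\<close>.\<close>

lemma lborel_integral_spd_orthogonal:
  fixes H W :: "real ^ 'n ^ 'n" and g :: "real ^ 'n \<Rightarrow> real"
  assumes H: "H \<in> spd_matrices" and W: "orthogonal_matrix W" and [measurable]: "g \<in> borel_measurable borel"
  shows "(LINT x|lborel. g x) = det H * (LINT x|lborel. g ((H ** W) *v x))"
proof -
  obtain Q d where Q: "orthogonal_matrix Q" and d: "\<And>i. 0 < d i"
    and HQ: "H = Q ** diag_matrix d ** transpose Q"
    using spd_spectral[OF H] by blast
  have "det Q * det Q = 1"
    using orthogonal_matrix_transpose_mult[OF Q] by (metis det_I det_mul det_transpose)
  then have det: "det H = prod d UNIV"
    by (simp add: HQ det_mul det_transpose det_diag_matrix)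
  have QW: "orthogonal_matrix (transpose Q ** W)"
    by (simp add: orthogonal_matrix_mul Q W)
  have "(LINT x|lborel. g x) = (LINT x|lborel. g (Q *v x))"
    by (rule lborel_integral_orthogonal_matrix[OF Q, symmetric]) simp
  also have "\<dots> = prod d UNIV * (LINT x|lborel. g (Q *v (diag_matrix d *v x)))"
    by (rule lborel_integral_diag_matrix[OF d]) simp
  also have "(LINT x|lborel. g (Q *v (diag_matrix d *v x)))
      = (LINT x|lborel. g (Q *v (diag_matrix d *v ((transpose Q ** W) *v x))))"
    by (rule lborel_integral_orthogonal_matrix[OF QW, symmetric]) simp
  finally show ?thesis
    unfolding det by (simp only: HQ matrix_vector_mul_assoc matrix_mul_assoc)
qed

subsection \<open>The Fisher metric\<close>

text \<open>Fubini: Lebesgue measure on a Euclidean space is the image of a product measure indexed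
  by its basis, and the factors are reindexed from coordinates to basis vectors.\<close>

lemma
  fixes f :: "'n::finite \<Rightarrow> real \<Rightarrow> real"
  assumes f: "\<And>i. integrable lborel (f i)"
  shows lborel_integrable_prod_vec: "integrable lborel (\<lambda>x :: real ^ 'n. \<Prod>i\<in>UNIV. f i (x $ i))"
    and lborel_integral_prod_vec:
      "(LINT x|lborel. (\<Prod>i\<in>UNIV. f i ((x :: real ^ 'n) $ i))) = (\<Prod>i\<in>UNIV. (LINT x|lborel. f i x))"
proof -
  \<comment> \<open>For a basis vector the description picks its unique index; other vectors never
    enter the products.\<close>
  define F where "F b = f (THE i. b = axis i 1)" for b :: "real ^ 'n"
  have F: "F (axis i 1) = f i" for i
    by (simp add: F_def axis_eq_axis)
  have F_int: "integrable lborel (F b)" for b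
    by (simp add: F_def f)
  have [measurable]: "f i \<in> borel_measurable borel" for i
    using borel_measurable_integrable[OF f[of i]] by simp
  interpret product_sigma_finite "\<lambda>_ :: real ^ 'n. lborel :: real measure" ..
  have comp: "(\<Sum>b\<in>Basis. \<phi> b * b $ i) = \<phi> (axis i 1)" for \<phi> :: "real ^ 'n \<Rightarrow> real" and i
    unfolding sum_Basis_vec by (simp add: axis_def if_distrib cong: if_cong)
  have prod_eq: "(\<Prod>i\<in>UNIV. f i (\<phi> (axis i 1))) = (\<Prod>b\<in>Basis. F b (\<phi> b))" for \<phi> :: "real ^ 'n \<Rightarrow> real"
    by (simp add: prod_Basis_vec F)
  show "integrable lborel (\<lambda>x :: real ^ 'n. \<Prod>i\<in>UNIV. f i (x $ i))"
    unfolding lborel_eq[where 'a = "real ^ 'n"]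
    by (subst integrable_distr_eq) (auto simp: comp prod_eq intro!: product_integrable_prod F_int)
  have "(LINT x|lborel. (\<Prod>i\<in>UNIV. f i ((x :: real ^ 'n) $ i)))
      = (LINT \<phi>|(\<Pi>\<^sub>M b\<in>(Basis :: (real ^ 'n) set). lborel). (\<Prod>b\<in>Basis. F b (\<phi> b)))"
    unfolding lborel_eq[where 'a = "real ^ 'n"]
    by (subst integral_distr) (auto simp: comp prod_eq)
  also have "\<dots> = (\<Prod>b\<in>Basis. (LINT x|lborel. F b x))"
    by (rule product_integral_prod) (auto simp: F_int)
  finally show "(LINT x|lborel. (\<Prod>i\<in>UNIV. f i ((x :: real ^ 'n) $ i))) = (\<Prod>i\<in>UNIV. (LINT x|lborel. f i x))"
    by (simp add: prod_Basis_vec F)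
qed

text \<open>\<open>x^2 - 1\<close> is the second Hermite polynomial. The moments 1, 1, 3 of orders
  0, 2, 4 give it mean 0, which will remove the cross terms, and second moment
  \<open>3 - 2 + 1 = 2\<close>.\<close>

lemma std_normal_hermite_moments:
  shows "has_bochner_integral lborel std_normal_density 1"
    and "has_bochner_integral lborel (\<lambda>x. std_normal_density x * (x\<^sup>2 - 1)) 0"
    and "has_bochner_integral lborel (\<lambda>x. std_normal_density x * (x\<^sup>2 - 1)\<^sup>2) 2"
proof -
  note m0 = std_normal_moment_even[of 0, simplified]
  have m2: "has_bochner_integral lborel (\<lambda>x. std_normal_density x * x\<^sup>2) 1"
    using std_normal_moment_even[of 1] by simp
  have m4: "has_bochner_integral lborel (\<lambda>x. std_normal_density x * x ^ 4) 3"
    using std_normal_moment_even[of 2] by (simp add: fact_numeral)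
  show "has_bochner_integral lborel std_normal_density 1"
    by (rule m0)
  show "has_bochner_integral lborel (\<lambda>x. std_normal_density x * (x\<^sup>2 - 1)) 0"
    using has_bochner_integral_diff[OF m2 m0] by (simp add: algebra_simps)
  have "has_bochner_integral lborel
      (\<lambda>x. std_normal_density x * x ^ 4 - 2 * (std_normal_density x * x\<^sup>2) + std_normal_density x) (3 - 2 * 1 + 1)"
    by (intro has_bochner_integral_add has_bochner_integral_diff has_bochner_integral_mult_right m0 m2 m4)
  moreover have "std_normal_density x * x ^ 4 - 2 * (std_normal_density x * x\<^sup>2) + std_normal_density x
      = std_normal_density x * (x\<^sup>2 - 1)\<^sup>2" for x
    by (simp add: algebra_simps power2_eq_square power4_eq_xxxx)
  ultimately show "has_bochner_integral lborel (\<lambda>x. std_normal_density x * (x\<^sup>2 - 1)\<^sup>2) 2"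
    by simp
qed

text \<open>Coordinates are independent, so each term of the expanded square is a product of
  one-dimensional integrals. For \<open>i \<noteq> j\<close> one factor is the mean of a Hermite
  polynomial, hence 0; for \<open>i = j\<close> the product is 2.\<close>

lemma std_normal_quadratic_moment:
  fixes l :: "'n::finite \<Rightarrow> real"
  shows "(LINT y|lborel. (\<Sum>i\<in>UNIV. l i * ((y $ i)\<^sup>2 - 1))\<^sup>2 * (\<Prod>i\<in>UNIV. std_normal_density ((y :: real ^ 'n) $ i)))
    = 2 * (\<Sum>i\<in>UNIV. (l i)\<^sup>2)"
proof -
  \<comment> \<open>The factor of the term \<open>(i, j)\<close> that depends on coordinate
    \<open>k\<close>; when \<open>i = j\<close> both polynomials fall on the same coordinate and
    square.\<close>
  define h where "h i j k z = std_normal_density z * ((if k = i then z\<^sup>2 - 1 else 1) * (if k = j then z\<^sup>2 - 1 else 1))"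
    for i j k :: 'n and z
  note hm = std_normal_hermite_moments
  have h_cases: "h i j k = (if k = i \<and> k = j then (\<lambda>x. std_normal_density x * (x\<^sup>2 - 1)\<^sup>2)
      else if k = i \<or> k = j then (\<lambda>x. std_normal_density x * (x\<^sup>2 - 1)) else std_normal_density)" for i j k
    by (auto simp: h_def fun_eq_iff power2_eq_square)
  have h_int: "has_bochner_integral lborel (h i j k) (if k = i \<and> k = j then 2 else if k = i \<or> k = j then 0 else 1)" for i j k
    unfolding h_cases using hm by simp
  note h_lint = has_bochner_integral_integral_eq[OF h_int]
  have h_integrable: "integrable lborel (h i j k)" for i j k
    using h_int[of i j k] by (simp add: has_bochner_integral_iff)
  have h_prod: "(\<Prod>k\<in>UNIV. (LINT z|lborel. h i j k z)) = (if i = j then 2 else 0)" for i j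
  proof (cases "i = j")
    case True
    then have "(\<Prod>k\<in>UNIV. (LINT z|lborel. h i j k z)) = (\<Prod>k\<in>UNIV. if k = i then 2 else 1)"
      by (intro prod.cong) (auto simp: h_lint)
    then show ?thesis using True by simp
  next
    case False
    have "(LINT z|lborel. h i j i z) = 0"
      using False by (simp add: h_lint)
    then show ?thesis
      using False by (auto intro!: prod_zero)
  qed
  have h_eq: "((y $ i)\<^sup>2 - 1) * ((y $ j)\<^sup>2 - 1) * (\<Prod>k\<in>UNIV. std_normal_density (y $ k))
      = (\<Prod>k\<in>UNIV. h i j k (y $ k))" for y :: "real ^ 'n" and i j
    by (simp add: h_def prod.distrib)
  have integrable: "integrable lborel (\<lambda>y :: real ^ 'n. \<Prod>k\<in>UNIV. h i j k (y $ k))" for i j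
    by (intro lborel_integrable_prod_vec h_integrable)
  have "(LINT y|lborel. (\<Sum>i\<in>UNIV. l i * ((y $ i)\<^sup>2 - 1))\<^sup>2 * (\<Prod>i\<in>UNIV. std_normal_density ((y :: real ^ 'n) $ i)))
      = (LINT y|lborel. (\<Sum>i\<in>UNIV. \<Sum>j\<in>UNIV. l i * l j * (\<Prod>k\<in>UNIV. h i j k ((y :: real ^ 'n) $ k))))"
    by (intro Bochner_Integration.integral_cong refl,
        simp only: power2_eq_square[of "sum _ _"] sum_product)
      (simp add: sum_distrib_left h_eq[symmetric] mult_ac)
  also have "\<dots> = (\<Sum>i\<in>UNIV. \<Sum>j\<in>UNIV. l i * l j * (if i = j then 2 else 0))"
    using integrable h_integrable
    by (simp add: Bochner_Integration.integral_sum lborel_integral_prod_vec h_prod)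
  also have "\<dots> = 2 * (\<Sum>i\<in>UNIV. (l i)\<^sup>2)"
    by (simp add: sum_distrib_left power2_eq_square mult_ac if_distrib cong: if_cong)
  finally show ?thesis .
qed

section \<open>The Gaussian density and its score in diagonalizing coordinates\<close>

lemma diag_conj_inverse:
  fixes M N :: "real ^ 'n ^ 'n"
  assumes MN: "M ** N = mat 1" and d: "\<And>i. d i \<noteq> 0"
  shows "matrix_inv (M ** diag_matrix d ** transpose M) = transpose N ** diag_matrix (\<lambda>i. 1 / d i) ** N"
proof (rule matrix_inv_eqI)
  have NM: "transpose M ** transpose N = mat 1"
    using MN matrix_left_right_inverse by (metis matrix_transpose_mul transpose_mat)
  have "(M ** diag_matrix d ** transpose M) ** (transpose N ** diag_matrix (\<lambda>i. 1 / d i) ** N)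
      = M ** (diag_matrix d ** diag_matrix (\<lambda>i. 1 / d i)) ** N"
    by (simp add: matrix_mul_assoc[symmetric] matrix_mult_cancel_left[OF NM])
  also have "\<dots> = mat 1"
    using d by (simp add: diag_matrix_mult diag_matrix_one MN)
  finally show "(M ** diag_matrix d ** transpose M) ** (transpose N ** diag_matrix (\<lambda>i. 1 / d i) ** N) = mat 1" .
qed

text \<open>Straight lines stay within one diagonalizing frame, so log density and determinant along
  \<open>X + t A\<close> become explicit functions of \<open>t\<close>.\<close>

lemma diag_conj_line:
  fixes M :: "real ^ 'n ^ 'n"
  shows "M ** transpose M + t *\<^sub>R (M ** diag_matrix l ** transpose M)
    = M ** diag_matrix (\<lambda>i. 1 + t * l i) ** transpose M"
proof -
  have "M ** transpose M = M ** diag_matrix (\<lambda>_. 1) ** transpose M"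
    by (simp add: diag_matrix_one)
  then show ?thesis
    by (simp only: vec_eq_iff vector_add_component vector_scaleR_component matrix_diag_conj_nth)
      (simp add: sum_distrib_left sum.distrib[symmetric] algebra_simps)
qed

lemma spd_orthogonal_inverse:
  fixes H W :: "real ^ 'n ^ 'n"
  assumes H: "H \<in> spd_matrices" and W: "orthogonal_matrix W"
  obtains N where "(H ** W) ** N = mat 1" "N ** (H ** W) = mat 1"
proof -
  have "(H ** W) ** (transpose W ** matrix_inv H) = mat 1"
    by (simp add: matrix_mul_assoc[symmetric] matrix_inv_left_right[OF spd_invertible[OF H]]
        matrix_mult_cancel_left[OF orthogonal_matrix_transpose_mult(2)[OF W]])
  then show thesis
    using that matrix_left_right_inverse by blast
qed

lemma det_diag_conj:
  fixes H W :: "real ^ 'n ^ 'n"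
  assumes W: "orthogonal_matrix W"
  shows "det ((H ** W) ** diag_matrix d ** transpose (H ** W)) = (det H)\<^sup>2 * prod d UNIV"
proof -
  have "det W * det W = 1"
    using orthogonal_matrix_transpose_mult[OF W] by (metis det_I det_mul det_transpose)
  then have "(det H * det W) * prod d UNIV * (det H * det W) = (det H)\<^sup>2 * prod d UNIV"
    by (simp add: power2_eq_square mult_ac)
  then show ?thesis
    by (simp add: det_mul det_transpose det_diag_matrix matrix_transpose_mul mult_ac)
qed

text \<open>In the coordinates \<open>x = M y\<close> the inverse covariance is diagonal, so the
  density splits into one-dimensional Gaussians. The factor \<open>1 / det H\<close> is what the
  change of variables cancels later.\<close>

lemma gaussian_density_diag_conj:
  fixes H W :: "real ^ 'n ^ 'n" and y :: "real ^ 'n"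
  assumes H: "H \<in> spd_matrices" and W: "orthogonal_matrix W" and d: "\<And>i. 0 < d i"
  defines "M \<equiv> H ** W"
  shows "gaussian_density (M ** diag_matrix d ** transpose M) (M *v y)
    = (1 / det H) * (\<Prod>i\<in>UNIV. 1 / sqrt (d i)) * (\<Prod>i\<in>UNIV. 1 / sqrt (2 * pi) * exp (- ((y $ i)\<^sup>2 / d i / 2)))"
proof -
  obtain N where MN: "M ** N = mat 1" and NM: "N ** M = mat 1"
    using spd_orthogonal_inverse[OF H W] unfolding M_def by blast
  have "(2 * pi) powr (real CARD('n) / 2) = sqrt (2 * pi) ^ CARD('n)"
    by (simp add: powr_half_sqrt[symmetric] powr_powr powr_realpow[symmetric] mult.commute)
  then have norm: "1 / (2 * pi) powr (real CARD('n) / 2) = (\<Prod>i\<in>(UNIV :: 'n set). 1 / sqrt (2 * pi))"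
    by (simp add: power_divide)
  have "sqrt (prod d A) = (\<Prod>i\<in>A. sqrt (d i))" for A
    by (induction A rule: infinite_finite_induct) (auto simp: real_sqrt_mult)
  then have sd: "sqrt (det (M ** diag_matrix d ** transpose M)) = det H * (\<Prod>i\<in>UNIV. sqrt (d i))"
    using spd_det_pos[OF H] d
    by (simp add: M_def det_diag_conj[OF W] real_sqrt_mult less_imp_le)
  have Nx: "N *v (M *v y) = y"
    by (simp add: matrix_vector_mul_assoc NM)
  have "matrix_inv (M ** diag_matrix d ** transpose M) = transpose N ** diag_matrix (\<lambda>i. 1 / d i) ** N"
    using d by (intro diag_conj_inverse[OF MN]) (metis less_irrefl)
  then have "(M *v y) \<bullet> (matrix_inv (M ** diag_matrix d ** transpose M) *v (M *v y))
      = (M *v y) \<bullet> (transpose N *v (diag_matrix (\<lambda>i. 1 / d i) *v (N *v (M *v y))))"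
    by (simp only: matrix_vector_mul_assoc matrix_mul_assoc)
  also have "\<dots> = y \<bullet> (diag_matrix (\<lambda>i. 1 / d i) *v y)"
    unfolding Nx by (metis Nx dot_lmul_matrix inner_commute transpose_matrix_vector)
  also have "\<dots> = (\<Sum>i\<in>UNIV. (y $ i)\<^sup>2 / d i)"
    by (simp add: inner_vec_def diag_matrix_mult_vec power2_eq_square)
  finally have "exp (- (1 / 2) * ((M *v y) \<bullet> (matrix_inv (M ** diag_matrix d ** transpose M) *v (M *v y))))
      = (\<Prod>i\<in>UNIV. exp (- ((y $ i)\<^sup>2 / d i / 2)))"
    by (simp add: exp_sum[symmetric] sum_negf sum_divide_distrib)
  then show ?thesis
    unfolding gaussian_density_def sd
    by (simp only: norm prod.distrib prod_dividef mult_1_left times_divide_eq_left[symmetric]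
        divide_divide_eq_left[symmetric]) (simp add: prod_dividef norm mult_ac)
qed

text \<open>Coordinate \<open>i\<close> contributes
  \<open>- ln (1 + t l) / 2 - y^2 / (2 (1 + t l))\<close> with \<open>l = l i\<close> and
  \<open>y = y $ i\<close>, whose derivative at 0 is \<open>l (y^2 - 1) / 2\<close>: a multiple of
  the second Hermite polynomial.\<close>

lemma deriv_ln_gaussian_density:
  fixes H W :: "real ^ 'n ^ 'n" and y :: "real ^ 'n"
  assumes H: "H \<in> spd_matrices" and W: "orthogonal_matrix W"
  defines "M \<equiv> H ** W"
  shows "deriv (\<lambda>t. ln (gaussian_density (M ** transpose M + t *\<^sub>R (M ** diag_matrix l ** transpose M)) (M *v y))) 0
    = (\<Sum>i\<in>UNIV. l i * ((y $ i)\<^sup>2 - 1)) / 2"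
proof (rule DERIV_imp_deriv)
  let ?f = "\<lambda>t. ln (gaussian_density (M ** transpose M + t *\<^sub>R (M ** diag_matrix l ** transpose M)) (M *v y))"
  let ?g = "\<lambda>t. (\<Sum>i\<in>UNIV. - ln (1 + t * l i) / 2 + (ln (1 / sqrt (2 * pi)) - (y $ i)\<^sup>2 / (1 + t * l i) / 2)) - ln (det H)"
  \<comment> \<open>The explicit log density is valid only while \<open>X + t A\<close> stays
    positive definite; a neighbourhood of 0 suffices for the derivative.\<close>
  have ev: "\<forall>\<^sub>F t in nhds 0. \<forall>i. 0 < 1 + t * l i"
  proof (rule eventually_all_finite)
    fix i
    have "((\<lambda>t. 1 + t * l i) \<longlongrightarrow> 1 + 0 * l i) (nhds 0)"
      by (intro tendsto_intros filterlim_ident)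
    then show "\<forall>\<^sub>F t in nhds 0. 0 < 1 + t * l i"
      by (rule order_tendstoD) simp
  qed
  have eq: "?f t = ?g t" if t: "\<forall>i. 0 < 1 + t * l i" for t
  proof -
    note dH = spd_det_pos[OF H]
    have ln3: "ln (a * b * c) = ln a + ln b + ln c" if "0 < a" "0 < b" "0 < c" for a b c :: real
      using that by (simp add: ln_mult_pos)
    have t': "1 + t * l i \<noteq> 0" for i
      using t by (metis less_irrefl)
    have "?f t = ln ((1 / det H) * (\<Prod>i\<in>UNIV. 1 / sqrt (1 + t * l i)) *
        (\<Prod>i\<in>UNIV. 1 / sqrt (2 * pi) * exp (- ((y $ i)\<^sup>2 / (1 + t * l i) / 2))))"
      unfolding diag_conj_line M_def using t by (subst gaussian_density_diag_conj[OF H W]) auto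
    also have "\<dots> = ln (1 / det H) + ln (\<Prod>i\<in>UNIV. 1 / sqrt (1 + t * l i)) +
        ln (\<Prod>i\<in>UNIV. 1 / sqrt (2 * pi) * exp (- ((y $ i)\<^sup>2 / (1 + t * l i) / 2)))"
      by (rule ln3) (use t dH in \<open>auto intro!: prod_pos\<close>)
    also have "ln (\<Prod>i\<in>UNIV. 1 / sqrt (1 + t * l i)) = (\<Sum>i\<in>UNIV. ln (1 / sqrt (1 + t * l i)))"
      using t' by (intro ln_prod) auto
    also have "ln (\<Prod>i\<in>UNIV. 1 / sqrt (2 * pi) * exp (- ((y $ i)\<^sup>2 / (1 + t * l i) / 2)))
        = (\<Sum>i\<in>UNIV. ln (1 / sqrt (2 * pi) * exp (- ((y $ i)\<^sup>2 / (1 + t * l i) / 2))))"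
      by (intro ln_prod) auto
    also have "\<dots> = (\<Sum>i\<in>UNIV. ln (1 / sqrt (2 * pi)) - (y $ i)\<^sup>2 / (1 + t * l i) / 2)"
      by (intro sum.cong refl) (simp add: ln_div)
    also have "(\<Sum>i\<in>UNIV. ln (1 / sqrt (1 + t * l i))) = (\<Sum>i\<in>UNIV. - ln (1 + t * l i) / 2)"
    proof (intro sum.cong refl)
      fix i
      have "0 < 1 + t * l i"
        using t by blast
      then show "ln (1 / sqrt (1 + t * l i)) = - ln (1 + t * l i) / 2"
        by (simp add: ln_div ln_sqrt)
    qed
    also have "ln (1 / det H) = - ln (det H)"
      using dH by (simp add: ln_div)
    finally show ?thesis
      unfolding sum.distrib by linarith
  qed
  have "(?g has_real_derivative (\<Sum>i\<in>UNIV. - l i / 2 + (y $ i)\<^sup>2 * l i / 2)) (at 0)"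
    by (auto intro!: derivative_eq_intros sum.cong simp: power2_eq_square)
  moreover have "(\<Sum>i\<in>UNIV. - l i / 2 + (y $ i)\<^sup>2 * l i / 2) = (\<Sum>i\<in>UNIV. l i * ((y $ i)\<^sup>2 - 1)) / 2"
    by (simp add: sum_divide_distrib algebra_simps diff_divide_distrib)
  ultimately have g: "(?g has_real_derivative (\<Sum>i\<in>UNIV. l i * ((y $ i)\<^sup>2 - 1)) / 2) (at 0)"
    by (simp only:)
  have "\<forall>\<^sub>F t in nhds 0. ?f t = ?g t"
    using ev by eventually_elim (rule eq)
  from DERIV_cong_ev[OF refl this refl] g
  show "(?f has_real_derivative (\<Sum>i\<in>UNIV. l i * ((y $ i)\<^sup>2 - 1)) / 2) (at 0)"
    by blast
qed

lemma fisher_metric_diag_conj: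
  fixes H W :: "real ^ 'n ^ 'n"
  assumes H: "H \<in> spd_matrices" and W: "orthogonal_matrix W"
  defines "M \<equiv> H ** W"
  shows "fisher_metric (M ** transpose M) (M ** diag_matrix l ** transpose M) (M ** diag_matrix l ** transpose M)
    = (\<Sum>i\<in>UNIV. (l i)\<^sup>2) / 2"
proof -
  obtain N where MN: "M ** N = mat 1" and NM: "N ** M = mat 1"
    using spd_orthogonal_inverse[OF H W] unfolding M_def by blast
  have Nx: "N *v (M *v y) = y" "M *v (N *v y) = y" for y
    by (simp_all add: matrix_vector_mul_assoc NM MN)
  let ?s = "\<lambda>y. (\<Sum>i\<in>UNIV. l i * ((y $ i)\<^sup>2 - 1)) / 2"
  let ?p = "\<lambda>y. \<Prod>i\<in>UNIV. std_normal_density ((y :: real ^ 'n) $ i)"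
  define g where "g x = deriv (\<lambda>t. ln (gaussian_density (M ** transpose M + t *\<^sub>R (M ** diag_matrix l ** transpose M)) x)) 0
    * deriv (\<lambda>t. ln (gaussian_density (M ** transpose M + t *\<^sub>R (M ** diag_matrix l ** transpose M)) x)) 0
    * gaussian_density (M ** transpose M) x" for x
  have dens: "gaussian_density (M ** transpose M) (M *v y) = 1 / det H * ?p y" for y
    using gaussian_density_diag_conj[OF H W, of "\<lambda>_. 1" y]
    by (simp add: M_def[symmetric] diag_matrix_one std_normal_density_def)
  have g: "g (M *v y) = (?s y)\<^sup>2 * (1 / det H * ?p y)" for y
    unfolding g_def dens deriv_ln_gaussian_density[OF H W, of l y, folded M_def] power2_eq_square ..
  \<comment> \<open>Measurability of \<open>g\<close> cannot be read off \<open>deriv\<close>; it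
    comes from the explicit formula in \<open>y\<close>, pulled back along
    \<open>y = N x\<close>.\<close>
  have "(\<lambda>y :: real ^ 'n. (?s y)\<^sup>2 * (1 / det H * ?p y)) \<in> borel_measurable borel"
    unfolding std_normal_density_def by (intro borel_measurable_continuous_onI continuous_intros) auto
  note meas = measurable_compose[OF borel_measurable_matrix_vector_mult[of N] this]
  have "g = (\<lambda>x. (?s (N *v x))\<^sup>2 * (1 / det H * ?p (N *v x)))"
    using g[of "N *v _"] by (simp only: Nx fun_eq_iff simp_thms)
  also have "\<dots> \<in> borel_measurable borel"
    by (rule meas)
  finally have [measurable]: "g \<in> borel_measurable borel" .
  have "fisher_metric (M ** transpose M) (M ** diag_matrix l ** transpose M) (M ** diag_matrix l ** transpose M)
      = (LINT x|lborel. g x)"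
    by (simp add: fisher_metric_def g_def)
  also have "\<dots> = det H * (LINT y|lborel. g (M *v y))"
    unfolding M_def by (rule lborel_integral_spd_orthogonal[OF H W]) simp
  also have "(LINT y|lborel. g (M *v y))
      = (LINT y|lborel. (1 / (4 * det H)) * ((\<Sum>i\<in>UNIV. l i * ((y $ i)\<^sup>2 - 1))\<^sup>2 * ?p y))"
    unfolding g by (simp add: power_divide mult_ac)
  also have "det H * \<dots> = (\<Sum>i\<in>UNIV. (l i)\<^sup>2) / 2"
    unfolding integral_mult_right_zero std_normal_quadratic_moment
    using spd_det_pos[OF H] by simp
  finally show ?thesis .
qed

section \<open>The trace form of the metric\<close>

lemma matrix_inv_mult_diag_conj:
  fixes M N :: "real ^ 'n ^ 'n"
  assumes MN: "M ** N = mat 1"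
  shows "matrix_inv (M ** transpose M) ** (M ** diag_matrix l ** transpose M) = transpose N ** diag_matrix l ** transpose M"
proof -
  have NM: "N ** M = mat 1"
    using MN matrix_left_right_inverse by blast
  have "matrix_inv (M ** transpose M) = transpose N ** N"
    using diag_conj_inverse[OF MN, of "\<lambda>_. 1"] by (simp add: diag_matrix_one)
  then show ?thesis
    by (simp add: matrix_mul_assoc[symmetric] matrix_mult_cancel_left[OF NM])
qed

lemma trace_conj_inverse:
  fixes M N X :: "real ^ 'n ^ 'n"
  assumes "M ** N = mat 1"
  shows "trace (N ** X ** M) = trace X"
  using assms by (metis matrix_mul_assoc matrix_mul_lid trace_mul_sym)

text \<open>\<open>X^-1 A = N^T diag(l) M^T\<close> is similar to \<open>diag(l)\<close>, so its
  square has trace \<open>\<Sum> l_i^2\<close>.\<close>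

lemma trace_form_diag_conj:
  fixes M N :: "real ^ 'n ^ 'n" and l :: "'n \<Rightarrow> real"
  assumes MN: "M ** N = mat 1"
  defines "X \<equiv> M ** transpose M" and "A \<equiv> M ** diag_matrix l ** transpose M"
  shows "trace (matrix_inv X ** A ** matrix_inv X ** A) = (\<Sum>i\<in>UNIV. (l i)\<^sup>2)"
proof -
  have MNT: "transpose M ** transpose N = mat 1"
    using MN by (metis matrix_left_right_inverse matrix_transpose_mul transpose_mat)
  have "matrix_inv X ** A ** matrix_inv X ** A = (matrix_inv X ** A) ** (matrix_inv X ** A)"
    by (simp add: matrix_mul_assoc)
  also have "\<dots> = transpose N ** (diag_matrix l ** diag_matrix l) ** transpose M"
    unfolding X_def A_def matrix_inv_mult_diag_conj[OF MN]
    by (simp add: matrix_mul_assoc[symmetric] matrix_mult_cancel_left[OF MNT])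
  finally show ?thesis
    by (simp add: trace_conj_inverse[OF MNT] diag_matrix_mult trace_diag_matrix power2_eq_square)
qed

text \<open>The frame \<open>M\<close> depends on the point and cannot be followed along a path. The
  trace form is free of it, which makes continuity and congruence invariance accessible.\<close>

lemma fisher_metric_eq_trace:
  fixes R A :: "real ^ 'n ^ 'n"
  assumes R: "R \<in> spd_matrices" and A: "transpose A = A"
  shows "fisher_metric R A A = trace (matrix_inv R ** A ** matrix_inv R ** A) / 2"
proof -
  obtain W l where W: "orthogonal_matrix W"
    and R': "R = (spd_sqrt R ** W) ** transpose (spd_sqrt R ** W)"
    and A': "A = (spd_sqrt R ** W) ** diag_matrix l ** transpose (spd_sqrt R ** W)"
    using simultaneous_diagonalization[OF R A] by blast
  note H = spd_sqrt_spd[OF R]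
  obtain N where "(spd_sqrt R ** W) ** N = mat 1"
    using spd_orthogonal_inverse[OF H W] by blast
  note trace_form_diag_conj[OF this, of l, folded R' A']
  then show ?thesis
    using fisher_metric_diag_conj[OF H W, of l, folded R' A'] by simp
qed

subsection \<open>Derivatives of log-determinants\<close>

lemma matrix_add_mult_distrib: "(A + B) ** C = A ** C + B ** (C :: real ^ 'n ^ 'n)"
  by (simp add: vec_eq_iff matrix_matrix_mult_def sum.distrib distrib_right)

lemma matrix_diff_mult_distrib: "(A - B) ** C = A ** C - B ** (C :: real ^ 'n ^ 'n)"
  by (simp add: vec_eq_iff matrix_matrix_mult_def sum_subtractf left_diff_distrib)

lemma matrix_mult_diff_distrib: "C ** (A - B) = C ** A - C ** (B :: real ^ 'n ^ 'n)"
  by (simp add: vec_eq_iff matrix_matrix_mult_def sum_subtractf right_diff_distrib)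

lemma bounded_linear_matrix_mult_left: "bounded_linear (\<lambda>X. X ** (B :: real ^ 'n ^ 'n))"
proof -
  have "linear (\<lambda>X. X ** (B :: real ^ 'n ^ 'n))"
    by (rule linearI) (simp_all add: vec_eq_iff matrix_matrix_mult_def sum.distrib sum_distrib_left algebra_simps)
  then show ?thesis by (simp add: linear_linear)
qed

lemma bounded_linear_matrix_mult_right: "bounded_linear (\<lambda>X. (B :: real ^ 'n ^ 'n) ** X)"
proof -
  have "linear (\<lambda>X. (B :: real ^ 'n ^ 'n) ** X)"
    by (rule linearI) (simp_all add: vec_eq_iff matrix_matrix_mult_def sum.distrib sum_distrib_left algebra_simps)
  then show ?thesis by (simp add: linear_linear)
qed

lemma bounded_linear_matrix_sandwich: "bounded_linear (\<lambda>X. (B :: real ^ 'n ^ 'n) ** X ** (C :: real ^ 'n ^ 'n))"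
  using bounded_linear_compose[OF bounded_linear_matrix_mult_left bounded_linear_matrix_mult_right] .

lemma bounded_linear_trace: "bounded_linear (trace :: real ^ 'n ^ 'n \<Rightarrow> real)"
proof -
  have "linear (trace :: real ^ 'n ^ 'n \<Rightarrow> real)"
    by (rule linearI) (simp_all add: trace_def sum.distrib sum_distrib_left)
  then show ?thesis by (simp add: linear_linear)
qed

lemma bounded_linear_transpose: "bounded_linear (transpose :: real ^ 'n ^ 'n \<Rightarrow> real ^ 'n ^ 'n)"
proof -
  have "linear (transpose :: real ^ 'n ^ 'n \<Rightarrow> real ^ 'n ^ 'n)"
    by (rule linearI) (simp_all add: transpose_def vec_eq_iff)
  then show ?thesis by (simp add: linear_linear)
qed

lemma bounded_linear_matrix_nth: "bounded_linear (\<lambda>X :: real ^ 'n ^ 'n. X $ i $ j)"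
  using bounded_linear_compose[OF bounded_linear_vec_nth bounded_linear_vec_nth] .

text \<open>The Leibniz expansion is a polynomial in the entries. Only existence of the derivative
  is taken from here; its value is found along straight lines.\<close>

lemma det_differentiable: "(det :: real ^ 'n ^ 'n \<Rightarrow> real) differentiable (at X within T)"
proof -
  have "(\<lambda>X :: real ^ 'n ^ 'n. \<Prod>i\<in>UNIV. X $ i $ p i) differentiable (at X within T)" for p
    unfolding differentiable_def
    by (rule exI) (rule has_derivative_prod, rule bounded_linear_imp_has_derivative, rule bounded_linear_matrix_nth)
  then have "(\<lambda>X :: real ^ 'n ^ 'n. det X) differentiable (at X within T)"
    unfolding det_def by (intro differentiable_sum differentiable_mult differentiable_const) auto
  then show ?thesis by simp
qed

lemma continuous_on_det [continuous_intros]: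
  fixes f :: "'a::topological_space \<Rightarrow> real ^ 'n ^ 'n"
  assumes "continuous_on T f"
  shows "continuous_on T (\<lambda>x. det (f x))"
proof (rule continuous_on_compose2[OF _ assms])
  show "continuous_on UNIV (det :: real ^ 'n ^ 'n \<Rightarrow> real)"
    by (rule differentiable_imp_continuous_on) (simp add: differentiable_on_def det_differentiable)
qed simp

lemma continuous_on_matrix_mult [continuous_intros]:
  fixes f g :: "'a::topological_space \<Rightarrow> real ^ 'n ^ 'n"
  assumes "continuous_on T f" "continuous_on T g"
  shows "continuous_on T (\<lambda>x. f x ** g x)"
  unfolding matrix_matrix_mult_def by (intro continuous_intros assms)

text \<open>Cramer's rule, which reduces continuity of the inverse to continuity of
  determinants.\<close>

lemma matrix_inv_nth:
  fixes A :: "real ^ 'n ^ 'n"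
  assumes "invertible A"
  shows "matrix_inv A $ k $ m = det (\<chi> i j. if j = k then axis m 1 $ i else A $ i $ j) / det A"
proof -
  have "A *v (matrix_inv A *v axis m 1) = axis m 1"
    by (simp add: matrix_vector_mul_assoc matrix_inv_left_right[OF assms])
  then have "(matrix_inv A *v axis m 1) $ k = det (\<chi> i j. if j = k then axis m 1 $ i else A $ i $ j) / det A"
    using cramer[of A "matrix_inv A *v axis m 1" "axis m 1"] assms
    by (simp add: invertible_det_nz)
  then show ?thesis
    by (simp add: matrix_vector_mult_basis column_def)
qed

lemma continuous_on_matrix_inv:
  fixes f :: "'a::topological_space \<Rightarrow> real ^ 'n ^ 'n"
  assumes f: "continuous_on T f" and inv: "\<And>x. x \<in> T \<Longrightarrow> invertible (f x)"
  shows "continuous_on T (\<lambda>x. matrix_inv (f x))"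
proof -
  have "continuous_on T (\<lambda>x. matrix_inv (f x) $ k $ m)" for k m
  proof -
    have "continuous_on T (\<lambda>x. (if j = k then axis m 1 $ i else f x $ i $ j))" for i j
      by (cases "j = k") (auto intro!: continuous_intros f)
    then have "continuous_on T (\<lambda>x. det (\<chi> i j. if j = k then axis m 1 $ i else f x $ i $ j) / det (f x))"
      using inv by (intro continuous_intros f) (auto simp: invertible_det_nz)
    then show ?thesis
      by (rule continuous_on_eq) (simp add: matrix_inv_nth inv)
  qed
  then have "continuous_on T (\<lambda>x. \<chi> k m. matrix_inv (f x) $ k $ m)"
    by (intro continuous_on_vec_lambda)
  then show ?thesis by simp
qed

text \<open>Jacobi's formula without cofactors. The value \<open>D A\<close> of the differential is
  read off the line \<open>X + s A\<close>, where the determinant is \<open>(det H)^2\<close> times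
  the product of the \<open>1 + s l_i\<close>; the chain rule carries it over to
  \<open>\<gamma>\<close>, and the sum of the \<open>l_i\<close> is the trace of
  \<open>X^-1 A\<close>.\<close>

lemma ln_det_has_derivative:
  fixes \<gamma> :: "real \<Rightarrow> real ^ 'n ^ 'n"
  assumes \<gamma>: "(\<gamma> has_vector_derivative A) (at t within T)"
    and X: "\<gamma> t \<in> spd_matrices" and A: "transpose A = A"
  shows "((\<lambda>s. ln (det (\<gamma> s))) has_real_derivative trace (matrix_inv (\<gamma> t) ** A)) (at t within T)"
proof -
  let ?X = "\<gamma> t"
  obtain W l where W: "orthogonal_matrix W"
    and X': "?X = (spd_sqrt ?X ** W) ** transpose (spd_sqrt ?X ** W)"
    and A': "A = (spd_sqrt ?X ** W) ** diag_matrix l ** transpose (spd_sqrt ?X ** W)"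
    using simultaneous_diagonalization[OF X A] by blast
  define H where "H = spd_sqrt ?X"
  define M where "M = H ** W"
  have H: "H \<in> spd_matrices"
    unfolding H_def by (rule spd_sqrt_spd[OF X])
  have XM: "?X = M ** transpose M" and AM: "A = M ** diag_matrix l ** transpose M"
    using X' A' by (simp_all add: M_def H_def)
  obtain N where MN: "M ** N = mat 1"
    using spd_orthogonal_inverse[OF H W] unfolding M_def by blast
  have tr: "trace (matrix_inv ?X ** A) = sum l UNIV"
  proof -
    have "transpose M ** transpose N = mat 1"
      using MN by (metis matrix_left_right_inverse matrix_transpose_mul transpose_mat)
    then show ?thesis
      unfolding XM AM matrix_inv_mult_diag_conj[OF MN]
      by (simp add: trace_conj_inverse trace_diag_matrix)
  qed
  obtain D where D: "(det has_derivative D) (at ?X)"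
    using det_differentiable[of ?X UNIV] unfolding differentiable_def by blast
  \<comment> \<open>Stated for any curve through \<open>?X\<close> with velocity \<open>A\<close>,
    because it serves both the straight line and \<open>\<gamma>\<close>.\<close>
  have chain: "((\<lambda>s. det (\<phi> s)) has_real_derivative D A) (at s within U)"
    if \<phi>: "(\<phi> has_vector_derivative A) (at s within U)" "\<phi> s = ?X" for \<phi> s U
  proof -
    have "(det has_derivative D) (at (\<phi> s) within \<phi> ` U)"
      using D \<phi>(2) by (simp add: has_derivative_at_withinI)
    from vector_derivative_diff_chain_within[OF \<phi>(1) this]
    show ?thesis
      by (simp add: has_real_derivative_iff_has_vector_derivative o_def)
  qed
  have "((\<lambda>s. det (?X + s *\<^sub>R A)) has_real_derivative D A) (at 0)"
    by (rule chain) (auto intro!: derivative_eq_intros)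
  moreover have "((\<lambda>s. (det H)\<^sup>2 * (\<Prod>i\<in>UNIV. 1 + s * l i)) has_real_derivative (det H)\<^sup>2 * sum l UNIV) (at 0)"
  proof (rule DERIV_cmult)
    have "((\<lambda>s. \<Prod>i\<in>UNIV. 1 + s * l i) has_derivative
        (\<lambda>y. \<Sum>i\<in>UNIV. y * l i * (\<Prod>j\<in>UNIV - {i}. 1 + 0 * l j))) (at 0)"
      by (rule has_derivative_prod) (auto intro!: derivative_eq_intros)
    then show "((\<lambda>s. \<Prod>i\<in>UNIV. 1 + s * l i) has_real_derivative sum l UNIV) (at 0)"
      by (simp add: has_field_derivative_def sum_distrib_left[symmetric] mult_commute_abs)
  qed
  moreover have "det (?X + s *\<^sub>R A) = (det H)\<^sup>2 * (\<Prod>i\<in>UNIV. 1 + s * l i)" for s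
    unfolding XM AM diag_conj_line unfolding M_def by (rule det_diag_conj[OF W])
  ultimately have DA: "D A = (det H)\<^sup>2 * sum l UNIV"
    using DERIV_unique by auto
  have detX: "det ?X = (det H)\<^sup>2"
    unfolding XM using det_diag_conj[OF W, of H "\<lambda>_. 1"] by (simp add: M_def diag_matrix_one)
  have "((\<lambda>s. ln (det (\<gamma> s))) has_real_derivative inverse (det ?X) * D A) (at t within T)"
    by (intro DERIV_chain2[OF DERIV_ln] chain \<gamma> spd_det_pos[OF X] refl)
  moreover have "inverse (det ?X) * D A = sum l UNIV"
    using spd_det_pos[OF H] by (simp add: detX DA mult.assoc[symmetric])
  ultimately show ?thesis
    by (simp add: tr)
qed

subsection \<open>Principal minors along a flag\<close>

definition coord_proj :: "'n set \<Rightarrow> real ^ 'n ^ 'n" where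
  "coord_proj S = diag_matrix (\<lambda>i. if i \<in> S then 1 else 0)"

text \<open>Padding the block with the identity keeps blocks of all sizes in one matrix type. The
  empty set gives \<open>mat 1\<close>, so the minor of order 0 is 1 and its logarithm 0.\<close>

definition compress :: "'n set \<Rightarrow> real ^ 'n ^ 'n \<Rightarrow> real ^ 'n ^ 'n" where
  "compress S X = coord_proj S ** X ** coord_proj S + (mat 1 - coord_proj S)"

text \<open>
  \<open>det (compress S X)\<close> is the principal minor of \<open>X\<close> on \<open>S\<close>, and \<open>block_inv S X\<close> is the inverse of that
  principal block, extended by zero.
\<close>

definition block_inv :: "'n set \<Rightarrow> real ^ 'n ^ 'n \<Rightarrow> real ^ 'n ^ 'n" where
  "block_inv S X = coord_proj S ** matrix_inv (compress S X) ** coord_proj S"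

lemma coord_proj_Int: "coord_proj S ** coord_proj T = coord_proj (S \<inter> T)"
  unfolding coord_proj_def diag_matrix_mult by (intro arg_cong[where f = diag_matrix] ext) simp

lemma coord_proj_idem: "coord_proj S ** coord_proj S = coord_proj S"
  by (simp add: coord_proj_Int)

lemma transpose_coord_proj: "transpose (coord_proj S) = coord_proj S"
  by (simp add: coord_proj_def transpose_diag_matrix)

lemma transpose_compress: "transpose X = X \<Longrightarrow> transpose (compress S X) = compress S X"
proof -
  assume X: "transpose X = X"
  have "transpose (compress S X) = transpose (coord_proj S ** X ** coord_proj S) + (transpose (mat 1) - transpose (coord_proj S))"
    by (simp add: compress_def transpose_def vec_eq_iff)
  then show ?thesis
    by (simp add: X compress_def matrix_transpose_mul transpose_coord_proj matrix_mul_assoc)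
qed

lemma compress_spd:
  assumes X: "X \<in> spd_matrices"
  shows "compress S X \<in> spd_matrices"
proof -
  let ?P = "coord_proj S"
  have "0 < x \<bullet> (compress S X *v x)" if x: "x \<noteq> 0" for x
  proof -
    have "compress S X *v x = ?P *v (X *v (?P *v x)) + (x - ?P *v x)"
      by (simp add: compress_def matrix_vector_mult_add_rdistrib matrix_vector_mult_diff_rdistrib
          matrix_vector_mul_assoc matrix_mul_assoc)
    moreover have "x \<bullet> (?P *v (X *v (?P *v x))) = (?P *v x) \<bullet> (X *v (?P *v x))"
      by (rule inner_symmetric_matrix[OF transpose_coord_proj])
    moreover have "x \<bullet> (x - ?P *v x) = (\<Sum>i\<in>UNIV. if i \<in> S then 0 else (x $ i)\<^sup>2)"
      unfolding inner_vec_def coord_proj_def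
      by (intro sum.cong) (auto simp: diag_matrix_mult_vec power2_eq_square)
    ultimately have eq: "x \<bullet> (compress S X *v x)
        = (?P *v x) \<bullet> (X *v (?P *v x)) + (\<Sum>i\<in>UNIV. if i \<in> S then 0 else (x $ i)\<^sup>2)"
      by (simp add: inner_add_right)
    show ?thesis
    proof (cases "?P *v x = 0")
      case False
      then show ?thesis
        using X unfolding eq by (intro add_pos_nonneg sum_nonneg) (auto simp: spd_matrices_def)
    next
      case True
      obtain i where i: "x $ i \<noteq> 0"
        using x by (auto simp: vec_eq_iff)
      have "(?P *v x) $ i = 0"
        using True by simp
      then have "i \<notin> S"
        using i by (auto simp: coord_proj_def diag_matrix_mult_vec)
      then have "0 < (\<Sum>i\<in>UNIV. if i \<in> S then 0 else (x $ i)\<^sup>2)"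
        using i by (intro sum_pos2[of _ i]) auto
      then show ?thesis
        unfolding eq True by simp
    qed
  qed
  then show ?thesis
    using transpose_compress[OF spd_transpose[OF X]] by (simp add: spd_matrices_def)
qed

lemma transpose_matrix_inv:
  fixes A :: "real ^ 'n ^ 'n"
  assumes "invertible A"
  shows "transpose (matrix_inv A) = matrix_inv (transpose A)"
proof -
  have "transpose A ** transpose (matrix_inv A) = mat 1"
    by (metis assms matrix_inv_left_right(2) matrix_transpose_mul transpose_mat)
  then show ?thesis
    by (simp add: matrix_inv_eqI)
qed

lemma transpose_block_inv:
  assumes "X \<in> spd_matrices"
  shows "transpose (block_inv S X) = block_inv S X"
  using compress_spd[OF assms, of S]
  by (simp add: block_inv_def matrix_transpose_mul transpose_coord_proj matrix_mul_assoc
      transpose_matrix_inv spd_invertible spd_transpose)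

text \<open>The projection commutes with \<open>compress S X\<close>, since both products equal
  \<open>P X P\<close>, and hence with its inverse. Geometrically, \<open>block_inv S X ** X\<close>
  is the X-orthogonal projection onto the coordinate subspace of \<open>S\<close>.\<close>

lemma block_inv_mult_proj:
  assumes X: "X \<in> spd_matrices"
  shows "block_inv S X ** X ** coord_proj S = coord_proj S"
proof -
  let ?P = "coord_proj S" and ?M = "compress S X"
  note inv = matrix_inv_left_right[OF spd_invertible[OF compress_spd[OF X]]]
  have PP: "?P ** (?P ** Y) = ?P ** Y" for Y
    by (simp add: matrix_mul_assoc coord_proj_idem)
  have MP: "?M ** ?P = ?P ** X ** ?P"
    by (simp add: compress_def matrix_add_mult_distrib matrix_diff_mult_distrib matrix_mul_assoc[symmetric] coord_proj_idem)
  have PM: "?P ** ?M = ?P ** X ** ?P"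
    by (simp add: compress_def matrix_add_ldistrib matrix_mult_diff_distrib matrix_mul_assoc[symmetric] coord_proj_idem PP)
  have comm: "matrix_inv ?M ** ?P = ?P ** matrix_inv ?M"
  proof -
    have "matrix_inv ?M ** ?P = matrix_inv ?M ** (?P ** ?M) ** matrix_inv ?M"
      by (simp add: matrix_mul_assoc[symmetric] inv)
    also have "\<dots> = matrix_inv ?M ** (?M ** ?P) ** matrix_inv ?M"
      by (simp only: MP PM)
    also have "\<dots> = ?P ** matrix_inv ?M"
      by (simp add: matrix_mul_assoc inv)
    finally show ?thesis .
  qed
  have "block_inv S X ** X ** ?P = ?P ** matrix_inv ?M ** (?P ** X ** ?P)"
    by (simp add: block_inv_def matrix_mul_assoc)
  also have "\<dots> = ?P ** matrix_inv ?M ** (?M ** ?P)"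
    by (simp only: MP)
  also have "\<dots> = ?P"
    by (simp add: matrix_mul_assoc[symmetric] matrix_mult_cancel_left[OF inv(2)] coord_proj_idem)
  finally show ?thesis .
qed

text \<open>The range of \<open>block_inv S X\<close> lies in the coordinates of \<open>T\<close>,
  on which \<open>block_inv T X ** X\<close> is the identity; transposing gives the other order.
  This is the composition rule for projections onto nested subspaces.\<close>

lemma block_inv_nested:
  assumes X: "X \<in> spd_matrices" and ST: "S \<subseteq> T"
  shows "block_inv T X ** X ** block_inv S X = block_inv S X"
    and "block_inv S X ** X ** block_inv T X = block_inv S X"
proof -
  have "coord_proj T ** block_inv S X = block_inv S X"
    using ST by (simp add: block_inv_def matrix_mul_assoc coord_proj_Int Int_absorb1)
  then have "block_inv T X ** X ** block_inv S X = (block_inv T X ** X ** coord_proj T) ** block_inv S X"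
    by (simp add: matrix_mul_assoc[symmetric])
  also have "\<dots> = block_inv S X"
    by (simp add: block_inv_mult_proj[OF X] \<open>coord_proj T ** block_inv S X = block_inv S X\<close>)
  finally show 1: "block_inv T X ** X ** block_inv S X = block_inv S X" .
  have "transpose (block_inv T X ** X ** block_inv S X) = block_inv S X ** X ** block_inv T X"
    by (simp add: matrix_transpose_mul transpose_block_inv[OF X] spd_transpose[OF X] matrix_mul_assoc)
  then show "block_inv S X ** X ** block_inv T X = block_inv S X"
    by (simp add: 1 transpose_block_inv[OF X])
qed

text \<open>The trace of a projection is its rank.\<close>

lemma trace_block_inv_mult:
  assumes X: "X \<in> spd_matrices"
  shows "trace (block_inv S X ** X) = real (card S)"
proof -
  have "trace (block_inv S X ** X) = trace (coord_proj S ** (block_inv S X ** X))"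
    by (simp add: block_inv_def matrix_mul_assoc coord_proj_idem)
  also have "\<dots> = trace (coord_proj S)"
    by (simp add: trace_mul_sym[of "coord_proj S"] block_inv_mult_proj[OF X])
  also have "\<dots> = real (card S)"
    by (simp add: coord_proj_def trace_diag_matrix sum.If_cases)
  finally show ?thesis .
qed

text \<open>Cyclicity of the trace moves the two coordinate projections from \<open>A\<close> to the
  inverse, which is how \<open>block_inv\<close> arises as the gradient of a log minor.\<close>

lemma ln_det_compress_has_derivative:
  fixes \<gamma> :: "real \<Rightarrow> real ^ 'n ^ 'n"
  assumes \<gamma>: "(\<gamma> has_vector_derivative A) (at t within T)"
    and X: "\<gamma> t \<in> spd_matrices" and A: "transpose A = A"
  shows "((\<lambda>s. ln (det (compress S (\<gamma> s)))) has_real_derivative trace (block_inv S (\<gamma> t) ** A)) (at t within T)"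
proof -
  let ?P = "coord_proj S"
  have "((\<lambda>s. ?P ** \<gamma> s ** ?P + (mat 1 - ?P)) has_vector_derivative ?P ** A ** ?P + 0) (at t within T)"
    by (intro has_vector_derivative_add has_vector_derivative_const
        bounded_linear.has_vector_derivative[OF bounded_linear_matrix_sandwich \<gamma>])
  then have "((\<lambda>s. compress S (\<gamma> s)) has_vector_derivative ?P ** A ** ?P) (at t within T)"
    by (simp add: compress_def)
  moreover have "transpose (?P ** A ** ?P) = ?P ** A ** ?P"
    by (simp add: matrix_transpose_mul transpose_coord_proj A matrix_mul_assoc)
  ultimately have "((\<lambda>s. ln (det (compress S (\<gamma> s)))) has_real_derivative
      trace (matrix_inv (compress S (\<gamma> t)) ** (?P ** A ** ?P))) (at t within T)"
    by (intro ln_det_has_derivative compress_spd X)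
  moreover have "trace (matrix_inv (compress S (\<gamma> t)) ** (?P ** A ** ?P)) = trace (block_inv S (\<gamma> t) ** A)"
    by (simp add: block_inv_def matrix_mul_assoc trace_mul_sym[of _ ?P])
  ultimately show ?thesis by simp
qed

lemma trace_square_diff_scaleR:
  fixes U V :: "real ^ 'n ^ 'n"
  shows "trace ((U - s *\<^sub>R V) ** (U - s *\<^sub>R V)) =
    trace (U ** U) - s * trace (V ** U) - s * trace (U ** V) + s\<^sup>2 * trace (V ** V)"
proof -
  have "(U - s *\<^sub>R V) ** (U - s *\<^sub>R V) =
      U ** U - s *\<^sub>R (V ** U) - s *\<^sub>R (U ** V) + s\<^sup>2 *\<^sub>R (V ** V)"
    by (simp add: vec_eq_iff matrix_matrix_mult_def sum_subtractf sum.distrib sum_distrib_left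
        algebra_simps power2_eq_square)
  then show ?thesis
    by (simp add: trace_def sum_subtractf sum.distrib sum_distrib_left)
qed

lemma trace_form_nonneg:
  fixes X A :: "real ^ 'n ^ 'n"
  assumes "X \<in> spd_matrices" "transpose A = A"
  shows "0 \<le> trace (matrix_inv X ** A ** matrix_inv X ** A)"
proof -
  obtain W l where W: "orthogonal_matrix W"
    and X': "X = (spd_sqrt X ** W) ** transpose (spd_sqrt X ** W)"
    and A': "A = (spd_sqrt X ** W) ** diag_matrix l ** transpose (spd_sqrt X ** W)"
    using simultaneous_diagonalization[OF assms] by blast
  obtain N where "(spd_sqrt X ** W) ** N = mat 1"
    using spd_orthogonal_inverse[OF spd_sqrt_spd[OF assms(1)] W] by blast
  from trace_form_diag_conj[OF this, of l, folded X' A'] show ?thesis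
    by (simp add: sum_nonneg)
qed

text \<open>
  The gradient of the Busemann function at \<open>X\<close> is \<open>Z = X G X\<close> with \<open>G = (\<Sum>i\<in>UNIV. l i *\<^sub>R E i)\<close>. Since
  \<open>E i ** X ** E j\<close> is \<open>E i\<close> for \<open>i = j\<close> and \<open>0\<close> otherwise, \<open>Z\<close> has squared norm \<open>\<Sum>i\<in>UNIV. (l i)\<^sup>2\<close> for
  the form \<open>trace (matrix_inv X ** U ** matrix_inv X ** V)\<close>, and the bound is Cauchy-Schwarz.
\<close>

lemma flag_gradient_bound:
  fixes X A :: "real ^ 'n ^ 'n" and r :: "'n \<Rightarrow> nat" and l :: "'n \<Rightarrow> real"
  assumes X: "X \<in> spd_matrices" and A: "transpose A = A" and r: "inj r"
  defines "E \<equiv> \<lambda>i. block_inv {j. r j \<le> r i} X - block_inv {j. r j < r i} X"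
  shows "(\<Sum>i\<in>UNIV. l i * trace (E i ** A))\<^sup>2
    \<le> (\<Sum>i\<in>UNIV. (l i)\<^sup>2) * trace (matrix_inv X ** A ** matrix_inv X ** A)"
proof -
  note inv = matrix_inv_left_right[OF spd_invertible[OF X]]
  \<comment> \<open>For different ranks both blocks of the smaller rank lie in both blocks of the
    larger, so all four products reduce to smaller blocks and cancel in pairs. For equal ranks
    \<open>T - S - S + S\<close> leaves \<open>T - S\<close>.\<close>
  have EXE: "E i ** X ** E j = (if i = j then E i else 0)" for i j
  proof (cases "r i" "r j" rule: linorder_cases)
    case less
    then have sub: "{k. r k \<le> r i} \<subseteq> {k. r k < r j}" "{k. r k < r i} \<subseteq> {k. r k < r j}"
      "{k. r k \<le> r i} \<subseteq> {k. r k \<le> r j}" "{k. r k < r i} \<subseteq> {k. r k \<le> r j}"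
      by auto
    show ?thesis
      using less unfolding E_def
      by (auto simp: matrix_diff_mult_distrib matrix_mult_diff_distrib block_inv_nested[OF X sub(1)]
          block_inv_nested[OF X sub(2)] block_inv_nested[OF X sub(3)] block_inv_nested[OF X sub(4)])
  next
    case equal
    then have "i = j"
      using r by (simp add: inj_eq)
    moreover have sub: "{k. r k < r j} \<subseteq> {k. r k \<le> r j}"
      by auto
    ultimately show ?thesis
      unfolding E_def
      by (auto simp: matrix_diff_mult_distrib matrix_mult_diff_distrib block_inv_nested[OF X sub]
          block_inv_nested[OF X order_refl])
  next
    case greater
    then have sub: "{k. r k \<le> r j} \<subseteq> {k. r k < r i}" "{k. r k < r j} \<subseteq> {k. r k < r i}"
      "{k. r k \<le> r j} \<subseteq> {k. r k \<le> r i}" "{k. r k < r j} \<subseteq> {k. r k \<le> r i}"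
      by auto
    show ?thesis
      using greater unfolding E_def
      by (auto simp: matrix_diff_mult_distrib matrix_mult_diff_distrib block_inv_nested[OF X sub(1)]
          block_inv_nested[OF X sub(2)] block_inv_nested[OF X sub(3)] block_inv_nested[OF X sub(4)])
  qed
  have trE: "trace (E i ** X) = 1" for i
  proof -
    have "{j. r j \<le> r i} = insert i {j. r j < r i}"
      using r by (auto simp: inj_eq le_less)
    then have "card {j. r j \<le> r i} = Suc (card {j. r j < r i})"
      by simp
    then show ?thesis
      by (simp add: E_def matrix_diff_mult_distrib trace_sub trace_block_inv_mult[OF X])
  qed
  define G where "G = (\<Sum>i\<in>UNIV. l i *\<^sub>R E i)"
  define c where "c = (\<Sum>i\<in>UNIV. (l i)\<^sup>2)"
  define b where "b = (\<Sum>i\<in>UNIV. l i * trace (E i ** A))"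
  define q where "q = trace (matrix_inv X ** A ** matrix_inv X ** A)"
  have tr_G: "trace (G ** Y) = (\<Sum>i\<in>UNIV. l i * trace (E i ** Y))" for Y
  proof -
    have "bounded_linear (\<lambda>Z. trace (Z ** Y))"
      by (rule bounded_linear_compose[OF bounded_linear_trace bounded_linear_matrix_mult_left])
    then have lin: "linear (\<lambda>Z. trace (Z ** Y))"
      by (simp add: linear_linear)
    show ?thesis
      using linear_sum[OF lin, of "\<lambda>i. l i *\<^sub>R E i" UNIV] linear_scale[OF lin] by (simp add: G_def)
  qed
  have GXG: "trace (G ** X ** G ** X) = c"
  proof -
    have "E i ** X ** G = l i *\<^sub>R E i" for i
    proof -
      have lin: "linear (\<lambda>Z. E i ** X ** Z)"
        using bounded_linear_matrix_mult_right[of "E i ** X"] by (simp add: linear_linear)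
      have "E i ** X ** G = (\<Sum>j\<in>UNIV. l j *\<^sub>R (E i ** X ** E j))"
        unfolding G_def linear_sum[OF lin] linear_scale[OF lin] ..
      also have "\<dots> = (\<Sum>j\<in>UNIV. if i = j then l i *\<^sub>R E i else 0)"
        by (intro sum.cong) (auto simp: EXE)
      finally show ?thesis by simp
    qed
    then have "E i ** (X ** G ** X) = l i *\<^sub>R (E i ** X)" for i
      by (simp add: matrix_mul_assoc matrix_scalar_ac scalar_matrix_assoc[symmetric])
    moreover have "trace (l i *\<^sub>R (E i ** X)) = l i" for i
      using trE[of i] by (simp add: trace_def sum_distrib_left[symmetric])
    ultimately show ?thesis
      by (simp add: matrix_mul_assoc[symmetric] tr_G c_def power2_eq_square)
  qed
  have ET: "transpose (E i) = E i" for i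
    by (simp add: E_def transpose_def[of "_ - _"] vec_eq_iff)
      (metis (no_types, lifting) transpose_block_inv[OF X] transpose_def vec_lambda_beta)
  have GT: "transpose G = G"
  proof -
    have lin: "linear (transpose :: real ^ 'n ^ 'n \<Rightarrow> _)"
      using bounded_linear_transpose by (simp add: linear_linear)
    show ?thesis
      using linear_sum[OF lin, of "\<lambda>i. l i *\<^sub>R E i" UNIV] linear_scale[OF lin] by (simp add: G_def ET)
  qed
  \<comment> \<open>Nonnegativity of the trace form at \<open>A - s Z\<close>, where
    \<open>X^-1 Z = G X\<close>. The choice \<open>s = b / c\<close> below minimizes this quadratic;
    \<open>c = 0\<close> is separate and means that all \<open>l i\<close> vanish.\<close>
  have quad: "0 \<le> q - 2 * s * b + s\<^sup>2 * c" for s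
  proof -
    let ?Y = "A - s *\<^sub>R (X ** G ** X)"
    have "transpose ?Y = transpose A - s *\<^sub>R transpose (X ** G ** X)"
      by (simp add: transpose_def vec_eq_iff)
    then have "transpose ?Y = ?Y"
      by (simp add: A matrix_transpose_mul GT spd_transpose[OF X] matrix_mul_assoc)
    from trace_form_nonneg[OF X this]
    have "0 \<le> trace ((matrix_inv X ** ?Y) ** (matrix_inv X ** ?Y))"
      by (simp add: matrix_mul_assoc)
    also have "matrix_inv X ** ?Y = matrix_inv X ** A - s *\<^sub>R (G ** X)"
    proof -
      have lin: "linear (\<lambda>Z. matrix_inv X ** Z)"
        using bounded_linear_matrix_mult_right by (simp add: linear_linear)
      have "matrix_inv X ** ?Y = matrix_inv X ** A - s *\<^sub>R (matrix_inv X ** (X ** G ** X))"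
        unfolding matrix_mult_diff_distrib linear_scale[OF lin] ..
      then show ?thesis
        by (simp add: matrix_mul_assoc inv)
    qed
    also have "trace (\<dots> ** \<dots>) = q - 2 * s * b + s\<^sup>2 * c"
    proof -
      let ?U = "matrix_inv X ** A" and ?V = "G ** X"
      note trace_square_diff_scaleR[of ?U s ?V]
      moreover have "trace (?V ** ?U) = b"
        by (simp add: matrix_mul_assoc[symmetric] matrix_mult_cancel_left[OF inv(1)] tr_G b_def)
      moreover have "trace (?U ** ?V) = trace (?V ** ?U)"
        by (rule trace_mul_sym)
      moreover have "trace (?V ** ?V) = c" "trace (?U ** ?U) = q"
        using GXG by (simp_all add: matrix_mul_assoc q_def)
      ultimately show ?thesis by simp
    qed
    finally show ?thesis .
  qed
  have "b\<^sup>2 \<le> c * q"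
  proof (cases "c = 0")
    case True
    then have "l i = 0" for i
      unfolding c_def by (subst (asm) sum_nonneg_eq_0_iff) auto
    then show ?thesis by (simp add: b_def True)
  next
    case False
    then have "0 < c"
      unfolding c_def by (simp add: sum_nonneg less_le)
    then have "c * (2 * (b / c) * b - (b / c)\<^sup>2 * c) = b\<^sup>2"
      by (simp add: field_simps power2_eq_square)
    moreover have "2 * (b / c) * b - (b / c)\<^sup>2 * c \<le> q"
      using quad[of "b / c"] by simp
    ultimately show ?thesis
      using \<open>0 < c\<close> by (metis mult_left_mono less_imp_le)
  qed
  then show ?thesis
    by (simp add: b_def c_def q_def)
qed

subsection \<open>Lengths of paths\<close>

lemma compress_diag_matrix: "compress S (diag_matrix d) = diag_matrix (\<lambda>i. if i \<in> S then d i else 1)"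
proof -
  have "coord_proj S ** diag_matrix d ** coord_proj S = diag_matrix (\<lambda>i. if i \<in> S then d i else 0)"
    unfolding coord_proj_def diag_matrix_mult by (intro arg_cong[where f = diag_matrix] ext) simp
  then show ?thesis
    unfolding compress_def by (simp add: vec_eq_iff coord_proj_def diag_matrix_def mat_def)
qed

lemma ln_det_compress_diag_exp: "ln (det (compress S (diag_matrix (\<lambda>i. exp (l i))))) = sum l S"
proof -
  have "det (compress S (diag_matrix (\<lambda>i. exp (l i)))) = exp (\<Sum>i\<in>UNIV. if i \<in> S then l i else 0)"
    unfolding compress_diag_matrix det_diag_matrix exp_sum[OF finite]
    by (intro prod.cong) auto
  then show ?thesis
    by (simp add: sum.If_cases)
qed

text \<open>Congruences are isometries: \<open>Y^-1 B\<close> is similar to \<open>X^-1 A\<close>.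
  This permits moving the end points to \<open>mat 1\<close> and a diagonal matrix.\<close>

lemma trace_form_congruence:
  fixes M N X A :: "real ^ 'n ^ 'n"
  assumes X: "invertible X" and MN: "M ** N = mat 1"
  defines "Y \<equiv> N ** X ** transpose N" and "B \<equiv> N ** A ** transpose N"
  shows "trace (matrix_inv Y ** B ** matrix_inv Y ** B) = trace (matrix_inv X ** A ** matrix_inv X ** A)"
proof -
  have NM: "N ** M = mat 1"
    using MN matrix_left_right_inverse by blast
  have MNT: "transpose N ** transpose M = mat 1" "transpose M ** transpose N = mat 1"
    using MN NM by (metis matrix_transpose_mul transpose_mat)+
  have "Y ** (transpose M ** matrix_inv X ** M) = mat 1"
    by (simp add: Y_def matrix_mul_assoc[symmetric] matrix_mult_cancel_left[OF MNT(1)]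
        matrix_mult_cancel_left[OF matrix_inv_left_right(1)[OF X]] NM)
  then have "matrix_inv Y = transpose M ** matrix_inv X ** M"
    by (rule matrix_inv_eqI)
  then have "matrix_inv Y ** B ** matrix_inv Y ** B
      = transpose M ** (matrix_inv X ** A ** matrix_inv X ** A) ** transpose N"
    by (simp add: B_def matrix_mul_assoc[symmetric] matrix_mult_cancel_left[OF MNT(1)]
        matrix_mult_cancel_left[OF MN])
  then show ?thesis
    by (simp add: trace_conj_inverse[OF MNT(1)])
qed

text \<open>Transposing the path leaves it unchanged, so \<open>A\<close> and its transpose are both
  derivatives at \<open>t\<close>; uniqueness holds at the end points too, where the derivative is
  one-sided.\<close>

lemma symmetric_path_derivative:
  fixes \<gamma> :: "real \<Rightarrow> real ^ 'n ^ 'n"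
  assumes "t \<in> {0..1}" and \<gamma>: "(\<gamma> has_vector_derivative A) (at t within {0..1})"
    and sym: "\<And>s. s \<in> {0..1} \<Longrightarrow> transpose (\<gamma> s) = \<gamma> s"
  shows "transpose A = A"
proof -
  have "((\<lambda>s. transpose (\<gamma> s)) has_vector_derivative transpose A) (at t within {0..1})"
    by (rule bounded_linear.has_vector_derivative[OF bounded_linear_transpose \<gamma>])
  then have "(\<gamma> has_vector_derivative transpose A) (at t within {0..1})"
    by (rule has_vector_derivative_transform[OF assms(1), rotated]) (simp add: sym)
  then show ?thesis
    using \<gamma> vector_derivative_within_closed_interval[OF zero_less_one assms(1), of \<gamma>] by metis
qed

lemma continuous_on_trace_form:
  fixes \<gamma> \<delta> :: "real \<Rightarrow> real ^ 'n ^ 'n"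
  assumes "continuous_on T \<gamma>" "continuous_on T \<delta>" "\<And>t. t \<in> T \<Longrightarrow> \<gamma> t \<in> spd_matrices"
  shows "continuous_on T (\<lambda>t. trace (matrix_inv (\<gamma> t) ** \<delta> t ** matrix_inv (\<gamma> t) ** \<delta> t))"
  by (intro continuous_on_compose2[OF linear_continuous_on[OF bounded_linear_trace, of UNIV]]
      continuous_on_matrix_mult continuous_on_matrix_inv assms spd_invertible) auto

text \<open>Integrating \<open>b' \<le> |l| sqrt q\<close> bounds the increment \<open>|l|^2\<close>
  of \<open>b\<close> by \<open>|l|\<close> times the length; then \<open>|l|\<close> is
  cancelled.\<close>

lemma trace_form_length_lower_bound:
  fixes \<gamma> \<delta> :: "real \<Rightarrow> real ^ 'n ^ 'n"
  assumes \<gamma>: "\<And>t. t \<in> {0..1} \<Longrightarrow> (\<gamma> has_vector_derivative \<delta> t) (at t within {0..1})"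
    and spd: "\<And>t. t \<in> {0..1} \<Longrightarrow> \<gamma> t \<in> spd_matrices"
    and \<delta>: "continuous_on {0..1} \<delta>"
    and ends: "\<gamma> 0 = mat 1" "\<gamma> 1 = diag_matrix (\<lambda>i. exp (l i))"
  shows "sqrt (\<Sum>i\<in>UNIV. (l i)\<^sup>2)
    \<le> integral {0..1} (\<lambda>t. sqrt (trace (matrix_inv (\<gamma> t) ** \<delta> t ** matrix_inv (\<gamma> t) ** \<delta> t)))"
proof -
  define q where "q t = trace (matrix_inv (\<gamma> t) ** \<delta> t ** matrix_inv (\<gamma> t) ** \<delta> t)" for t
  define c where "c = (\<Sum>i\<in>UNIV. (l i)\<^sup>2)"
  \<comment> \<open>The index type carries no order; any numbering of it provides a flag of
    coordinate subspaces.\<close>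
  obtain r :: "'n \<Rightarrow> nat" where r: "inj r"
    using finite_imp_inj_to_nat_seg[of "UNIV :: 'n set"] by auto
  let ?T = "\<lambda>i. {j. r j \<le> r i}" and ?S = "\<lambda>i. {j. r j < r i}"
  define b where "b t = (\<Sum>i\<in>UNIV. l i * (ln (det (compress (?T i) (\<gamma> t))) - ln (det (compress (?S i) (\<gamma> t)))))" for t
  define b' where "b' t = (\<Sum>i\<in>UNIV. l i * trace ((block_inv (?T i) (\<gamma> t) - block_inv (?S i) (\<gamma> t)) ** \<delta> t))" for t
  have sym: "transpose (\<delta> t) = \<delta> t" if "t \<in> {0..1}" for t
    using symmetric_path_derivative[OF that \<gamma>[OF that]] spd spd_transpose by blast
  have "(b has_real_derivative b' t) (at t within {0..1})" if t: "t \<in> {0..1}" for t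
    unfolding b_def[abs_def] b'_def matrix_diff_mult_distrib trace_sub
    by (intro DERIV_sum DERIV_cmult DERIV_diff ln_det_compress_has_derivative \<gamma> spd sym t)
  then have "(b' has_integral (b 1 - b 0)) {0..1}"
    by (intro fundamental_theorem_of_calculus)
      (auto simp: has_real_derivative_iff_has_vector_derivative)
  moreover have "b 0 = 0"
  proof -
    have "\<gamma> 0 = diag_matrix (\<lambda>i. exp ((\<lambda>_. 0) i))"
      by (simp add: ends diag_matrix_one)
    then show ?thesis
      unfolding b_def by (simp only: ln_det_compress_diag_exp) simp
  qed
  \<comment> \<open>Consecutive index sets differ by \<open>i\<close> alone, so the log ratio of
    their minors at the end point is \<open>l i\<close>, and its weight is again
    \<open>l i\<close>.\<close>
  moreover have "b 1 = c"
  proof -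
    have "?T i = insert i (?S i)" for i
      using r by (auto simp: inj_eq le_less)
    then have "sum l (?T i) - sum l (?S i) = l i" for i
      by simp
    then show ?thesis
      by (simp add: b_def ends ln_det_compress_diag_exp c_def power2_eq_square)
  qed
  ultimately have b': "(b' has_integral c) {0..1}"
    by simp
  have cont: "continuous_on {0..1} \<gamma>"
    using \<gamma> by (rule continuous_on_vector_derivative)
  have "continuous_on {0..1} q"
    unfolding q_def by (rule continuous_on_trace_form[OF cont \<delta> spd])
  then have q: "(\<lambda>t. sqrt (q t)) integrable_on {0..1}"
    by (intro integrable_continuous_interval continuous_intros)
  have "b' t \<le> sqrt c * sqrt (q t)" if t: "t \<in> {0..1}" for t
  proof -
    have "(b' t)\<^sup>2 \<le> c * q t"
      unfolding b'_def c_def q_def by (rule flag_gradient_bound[OF spd[OF t] sym[OF t] r])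
    then have "\<bar>b' t\<bar> \<le> sqrt (c * q t)"
      by (metis real_sqrt_abs real_sqrt_le_iff)
    then show ?thesis
      by (simp add: real_sqrt_mult)
  qed
  then have "c \<le> sqrt c * integral {0..1} (\<lambda>t. sqrt (q t))"
    using has_integral_le[OF b' has_integral_mult_right[OF integrable_integral[OF q], of "sqrt c"]] by simp
  moreover have "0 \<le> integral {0..1} (\<lambda>t. sqrt (q t))"
    using q spd sym unfolding q_def by (intro integral_nonneg) (auto intro!: trace_form_nonneg)
  moreover have c0: "0 \<le> c"
    by (simp add: c_def sum_nonneg)
  ultimately have "sqrt c \<le> integral {0..1} (\<lambda>t. sqrt (q t))"
  proof (cases "c = 0")
    case False
    then have "0 < sqrt c" using c0 by simp
    moreover have "sqrt c * sqrt c \<le> sqrt c * integral {0..1} (\<lambda>t. sqrt (q t))"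
      using \<open>c \<le> sqrt c * _\<close> c0 by simp
    ultimately show ?thesis by (simp only: mult_le_cancel_left_pos)
  qed simp
  then show ?thesis
    by (simp add: c_def q_def)
qed

lemma fisher_length_eq:
  fixes \<gamma> \<delta> :: "real \<Rightarrow> real ^ 'n ^ 'n"
  assumes \<gamma>: "\<And>t. t \<in> {0..1} \<Longrightarrow> (\<gamma> has_vector_derivative \<delta> t) (at t within {0..1})"
    and spd: "\<And>t. t \<in> {0..1} \<Longrightarrow> \<gamma> t \<in> spd_matrices"
  shows "fisher_length \<gamma>
    = integral {0..1} (\<lambda>t. sqrt (trace (matrix_inv (\<gamma> t) ** \<delta> t ** matrix_inv (\<gamma> t) ** \<delta> t))) / sqrt 2"
proof -
  have "fisher_length \<gamma>
      = integral {0..1} (\<lambda>t. sqrt (trace (matrix_inv (\<gamma> t) ** \<delta> t ** matrix_inv (\<gamma> t) ** \<delta> t)) / sqrt 2)"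
    unfolding fisher_length_def
  proof (rule integral_cong)
    fix t :: real assume t: "t \<in> {0..1}"
    have "transpose (\<delta> t) = \<delta> t"
      using symmetric_path_derivative[OF t \<gamma>[OF t]] spd spd_transpose by blast
    moreover have "vector_derivative \<gamma> (at t within {0..1}) = \<delta> t"
      using t by (intro vector_derivative_within_closed_interval \<gamma>) auto
    ultimately show "sqrt (fisher_metric (\<gamma> t) (vector_derivative \<gamma> (at t within {0..1})) (vector_derivative \<gamma> (at t within {0..1})))
        = sqrt (trace (matrix_inv (\<gamma> t) ** \<delta> t ** matrix_inv (\<gamma> t) ** \<delta> t)) / sqrt 2"
      by (simp add: fisher_metric_eq_trace spd[OF t] real_sqrt_divide)
  qed
  then show ?thesis
    by simp
qed

text \<open>Congruence by \<open>N = M^-1\<close> preserves the speed and brings the end points to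
  the normalized position.\<close>

lemma fisher_length_lower_bound:
  fixes \<gamma> :: "real \<Rightarrow> real ^ 'n ^ 'n" and M N :: "real ^ 'n ^ 'n"
  assumes \<gamma>: "smooth_path \<gamma>" "path_image \<gamma> \<subseteq> spd_matrices"
    and MN: "M ** N = mat 1"
    and ends: "pathstart \<gamma> = M ** transpose M"
      "pathfinish \<gamma> = M ** diag_matrix (\<lambda>i. exp (l i)) ** transpose M"
  shows "sqrt (\<Sum>i\<in>UNIV. (l i)\<^sup>2) / sqrt 2 \<le> fisher_length \<gamma>"
proof -
  obtain D :: "nat \<Rightarrow> real \<Rightarrow> real ^ 'n ^ 'n" where D0: "D 0 = \<gamma>"
    and D: "\<And>k t. t \<in> {0..1} \<Longrightarrow> (D k has_vector_derivative D (Suc k) t) (at t within {0..1})"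
    using \<gamma>(1) unfolding smooth_path_def by blast
  have NM: "N ** M = mat 1"
    using MN matrix_left_right_inverse by blast
  have NMT: "transpose M ** transpose N = mat 1"
    using NM by (metis matrix_transpose_mul transpose_mat)
  have "invertible N"
    using MN NM by (auto simp: invertible_def)
  have \<gamma>': "(\<gamma> has_vector_derivative D 1 t) (at t within {0..1})" if "t \<in> {0..1}" for t
    using D[OF that, of 0] by (simp add: D0)
  have spd: "\<gamma> t \<in> spd_matrices" if "t \<in> {0..1}" for t
    using \<gamma>(2) that by (auto simp: path_image_def)
  \<comment> \<open>The velocity is continuous because it has the derivative
    \<open>D 2\<close>.\<close>
  have "continuous_on {0..1} (D 1)"
    using D[of _ 1] by (rule continuous_on_vector_derivative)
  note bl = bounded_linear_matrix_sandwich[of N "transpose N"]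
  have "sqrt (\<Sum>i\<in>UNIV. (l i)\<^sup>2) \<le> integral {0..1} (\<lambda>t. sqrt (trace
      (matrix_inv (N ** \<gamma> t ** transpose N) ** (N ** D 1 t ** transpose N) **
        matrix_inv (N ** \<gamma> t ** transpose N) ** (N ** D 1 t ** transpose N))))"
  proof (rule trace_form_length_lower_bound)
    show "((\<lambda>t. N ** \<gamma> t ** transpose N) has_vector_derivative N ** D 1 t ** transpose N) (at t within {0..1})"
      if "t \<in> {0..1}" for t
      by (rule bounded_linear.has_vector_derivative[OF bl \<gamma>'[OF that]])
    show "N ** \<gamma> t ** transpose N \<in> spd_matrices" if "t \<in> {0..1}" for t
      by (rule spd_congruence[OF spd[OF that] \<open>invertible N\<close>])
    show "continuous_on {0..1} (\<lambda>t. N ** D 1 t ** transpose N)"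
      by (intro continuous_intros \<open>continuous_on {0..1} (D 1)\<close>)
    show "N ** \<gamma> 0 ** transpose N = mat 1"
      using ends(1) by (simp add: pathstart_def matrix_mul_assoc[symmetric] matrix_mult_cancel_left[OF NM] NMT)
    show "N ** \<gamma> 1 ** transpose N = diag_matrix (\<lambda>i. exp (l i))"
      using ends(2) by (simp add: pathfinish_def matrix_mul_assoc[symmetric] matrix_mult_cancel_left[OF NM] NMT)
  qed
  also have "\<dots> = integral {0..1} (\<lambda>t. sqrt (trace (matrix_inv (\<gamma> t) ** D 1 t ** matrix_inv (\<gamma> t) ** D 1 t)))"
    by (intro integral_cong) (simp add: trace_form_congruence[OF spd_invertible[OF spd] MN])
  finally have "sqrt (\<Sum>i\<in>UNIV. (l i)\<^sup>2)
      \<le> integral {0..1} (\<lambda>t. sqrt (trace (matrix_inv (\<gamma> t) ** D 1 t ** matrix_inv (\<gamma> t) ** D 1 t)))" .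
  moreover have "fisher_length \<gamma>
      = integral {0..1} (\<lambda>t. sqrt (trace (matrix_inv (\<gamma> t) ** D 1 t ** matrix_inv (\<gamma> t) ** D 1 t))) / sqrt 2"
    by (rule fisher_length_eq[OF \<gamma>' spd])
  ultimately show ?thesis
    by (simp only: divide_right_mono real_sqrt_ge_zero zero_le_numeral)
qed

section \<open>The minimizing path and the distance\<close>

lemma diag_matrix_has_vector_derivative:
  fixes f :: "real \<Rightarrow> 'n::finite \<Rightarrow> real"
  assumes "\<And>i. ((\<lambda>t. f t i) has_real_derivative f' i) (at t within T)"
  shows "((\<lambda>t. diag_matrix (f t)) has_vector_derivative diag_matrix f') (at t within T)"
proof -
  define C where "C k = diag_matrix (\<lambda>i. if i = k then 1 else 0)" for k :: 'n
  have C: "diag_matrix d = (\<Sum>k\<in>UNIV. d k *\<^sub>R C k)" for d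
  proof -
    have "diag_matrix d $ i $ j = (\<Sum>k\<in>UNIV. d k *\<^sub>R C k) $ i $ j" for i j
      by (cases "i = j") (simp_all add: C_def diag_matrix_def if_distrib[of "\<lambda>x. _ * x"] cong: if_cong)
    then show ?thesis by (simp add: vec_eq_iff)
  qed
  have "((\<lambda>t. \<Sum>k\<in>UNIV. f t k *\<^sub>R C k) has_vector_derivative (\<Sum>k\<in>UNIV. f t k *\<^sub>R 0 + f' k *\<^sub>R C k)) (at t within T)"
    by (intro has_vector_derivative_sum has_vector_derivative_scaleR has_vector_derivative_const assms)
  then show ?thesis
    by (simp add: C)
qed

lemma fisher_length_geodesic:
  fixes M N :: "real ^ 'n ^ 'n" and l :: "'n \<Rightarrow> real"
  assumes MN: "M ** N = mat 1"
  defines "\<gamma> \<equiv> \<lambda>t. M ** diag_matrix (\<lambda>i. exp (t * l i)) ** transpose M"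
  shows "smooth_path \<gamma>" and "path_image \<gamma> \<subseteq> spd_matrices"
    and "fisher_length \<gamma> = sqrt (\<Sum>i\<in>UNIV. (l i)\<^sup>2) / sqrt 2"
proof -
  have NM: "N ** M = mat 1"
    using MN matrix_left_right_inverse by blast
  have spd: "\<gamma> t \<in> spd_matrices" for t
    unfolding \<gamma>_def using MN NM by (intro spd_congruence) (auto simp: diag_matrix_spd_iff invertible_def)
  then show "path_image \<gamma> \<subseteq> spd_matrices"
    by (auto simp: path_image_def)
  \<comment> \<open>Each derivative brings down one more factor \<open>l i\<close>.\<close>
  define D where "D k t = M ** diag_matrix (\<lambda>i. l i ^ k * exp (t * l i)) ** transpose M" for k :: nat and t
  have D: "(D k has_vector_derivative D (Suc k) t) (at t within T)" for k t T
    unfolding D_def[abs_def]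
    by (intro bounded_linear.has_vector_derivative[OF bounded_linear_matrix_sandwich]
        diag_matrix_has_vector_derivative) (auto intro!: derivative_eq_intros)
  have D0: "D 0 = \<gamma>"
    by (simp add: D_def \<gamma>_def fun_eq_iff)
  then show "smooth_path \<gamma>"
    unfolding smooth_path_def using D by blast
  have \<gamma>': "(\<gamma> has_vector_derivative D 1 t) (at t within {0..1})" for t
    using D[of 0] by (simp add: D0)
  have "trace (matrix_inv (\<gamma> t) ** D 1 t ** matrix_inv (\<gamma> t) ** D 1 t) = (\<Sum>i\<in>UNIV. (l i)\<^sup>2)" for t
  proof -
    \<comment> \<open>The halved exponent makes \<open>?E t\<close> a square root of
      \<open>diag(e^(t l))\<close>. In the moving frame \<open>M ** ?E t\<close> the point is the
      frame times its transpose and the velocity is always \<open>diag(l)\<close>, so the speed is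
      constant.\<close>
    let ?E = "\<lambda>s. diag_matrix (\<lambda>i. exp (s * l i / 2))"
    have E: "?E t ** ?E t = diag_matrix (\<lambda>i. exp (t * l i))" "?E t ** ?E (- t) = mat 1"
      "?E t ** diag_matrix l ** ?E t = diag_matrix (\<lambda>i. l i * exp (t * l i))"
      unfolding diag_matrix_mult diag_matrix_one[symmetric]
      by (auto intro!: arg_cong[where f = diag_matrix] simp: exp_add[symmetric] mult_ac)
    have inv: "(M ** ?E t) ** (?E (- t) ** N) = mat 1"
      using E(2) MN by (metis matrix_mul_assoc matrix_mul_rid)
    have "\<gamma> t = (M ** ?E t) ** transpose (M ** ?E t)"
      by (simp add: \<gamma>_def E(1)[symmetric] matrix_transpose_mul transpose_diag_matrix matrix_mul_assoc)
    moreover have "D 1 t = (M ** ?E t) ** diag_matrix l ** transpose (M ** ?E t)"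
      by (simp add: D_def E(3)[symmetric] matrix_transpose_mul transpose_diag_matrix matrix_mul_assoc)
    ultimately show ?thesis
      using trace_form_diag_conj[OF inv, of l] by simp
  qed
  then show "fisher_length \<gamma> = sqrt (\<Sum>i\<in>UNIV. (l i)\<^sup>2) / sqrt 2"
    unfolding fisher_length_eq[OF \<gamma>' spd] by simp
qed

lemma fisher_rao_dist_diag_conj:
  fixes M N :: "real ^ 'n ^ 'n"
  assumes MN: "M ** N = mat 1"
  shows "fisher_rao_dist (M ** transpose M) (M ** diag_matrix (\<lambda>i. exp (l i)) ** transpose M)
    = sqrt (\<Sum>i\<in>UNIV. (l i)\<^sup>2) / sqrt 2"
  unfolding fisher_rao_dist_def
proof (rule cInf_eq_minimum)
  let ?\<gamma> = "\<lambda>t. M ** diag_matrix (\<lambda>i. exp (t * l i)) ** transpose M"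
  have "pathstart ?\<gamma> = M ** transpose M" "pathfinish ?\<gamma> = M ** diag_matrix (\<lambda>i. exp (l i)) ** transpose M"
    by (simp_all add: pathstart_def pathfinish_def diag_matrix_one)
  then show "sqrt (\<Sum>i\<in>UNIV. (l i)\<^sup>2) / sqrt 2 \<in> {fisher_length \<gamma> | \<gamma>. smooth_path \<gamma> \<and>
      path_image \<gamma> \<subseteq> spd_matrices \<and> pathstart \<gamma> = M ** transpose M \<and>
      pathfinish \<gamma> = M ** diag_matrix (\<lambda>i. exp (l i)) ** transpose M}"
    using fisher_length_geodesic[OF MN, of l] by (intro CollectI exI[of _ ?\<gamma>]) simp
next
  fix x assume "x \<in> {fisher_length \<gamma> | \<gamma>. smooth_path \<gamma> \<and>
      path_image \<gamma> \<subseteq> spd_matrices \<and> pathstart \<gamma> = M ** transpose M \<and>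
      pathfinish \<gamma> = M ** diag_matrix (\<lambda>i. exp (l i)) ** transpose M}"
  then show "sqrt (\<Sum>i\<in>UNIV. (l i)\<^sup>2) / sqrt 2 \<le> x"
    using fisher_length_lower_bound[OF _ _ MN] by blast
qed

theorem theorem1:
  fixes R S :: "real ^ 'n ^ 'n"
  assumes "R \<in> spd_matrices" and "S \<in> spd_matrices"
  shows "(fisher_rao_dist R S)\<^sup>2 =
    1 / 2 * trace
      (spd_log (matrix_inv (spd_sqrt R) ** S ** matrix_inv (spd_sqrt R)) **
       spd_log (matrix_inv (spd_sqrt R) ** S ** matrix_inv (spd_sqrt R)))"
proof -
  define H where "H = spd_sqrt R"
  note H = spd_sqrt_spd[OF assms(1), folded H_def]
  note inv = matrix_inv_left_right[OF spd_invertible[OF H]]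
  obtain W s where W: "orthogonal_matrix W" and R: "R = (H ** W) ** transpose (H ** W)"
    and S: "S = (H ** W) ** diag_matrix s ** transpose (H ** W)"
    using simultaneous_diagonalization[OF assms(1) spd_transpose[OF assms(2)]] unfolding H_def by blast
  \<comment> \<open>The outer factors \<open>H\<close> of \<open>S\<close> cancel, so the
    \<open>s i\<close> are the eigenvalues of the matrix under the logarithm.\<close>
  have conj: "matrix_inv H ** S ** matrix_inv H = W ** diag_matrix s ** transpose W"
    by (simp add: S matrix_transpose_mul spd_transpose[OF H] matrix_mul_assoc[symmetric]
        matrix_mult_cancel_left[OF inv(2)] inv)
  obtain N where MN: "(H ** W) ** N = mat 1" and NM: "N ** (H ** W) = mat 1"
    using spd_orthogonal_inverse[OF H W] by blast
  \<comment> \<open>This congruence of \<open>S\<close> is \<open>diag_matrix s\<close>, which makes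
    every \<open>s i\<close> positive and its logarithm meaningful.\<close>
  have "N ** S ** transpose N \<in> spd_matrices"
    using MN NM by (intro spd_congruence assms(2)) (auto simp: invertible_def)
  moreover have "transpose (H ** W) ** transpose N = mat 1"
    using NM by (metis matrix_transpose_mul transpose_mat)
  then have "N ** S ** transpose N = diag_matrix s"
    unfolding S by (metis NM matrix_mul_assoc matrix_mul_lid matrix_mul_rid)
  ultimately have s: "0 < s i" for i
    by (simp add: diag_matrix_spd_iff)
  define l where "l i = ln (s i)" for i
  have s_exp: "s = (\<lambda>i. exp (l i))"
    using s by (simp add: l_def)
  have log: "spd_log (matrix_inv H ** S ** matrix_inv H) = W ** diag_matrix l ** transpose W"
    unfolding conj s_exp by (rule spd_log_diag[OF W])
  have "trace ((W ** diag_matrix l ** transpose W) ** (W ** diag_matrix l ** transpose W)) = (\<Sum>i\<in>UNIV. (l i)\<^sup>2)"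
    using orthogonal_matrix_transpose_mult[OF W]
    by (simp add: orthogonal_diag_mult[OF W] trace_conj_inverse trace_diag_matrix power2_eq_square)
  moreover have "fisher_rao_dist R S = sqrt (\<Sum>i\<in>UNIV. (l i)\<^sup>2) / sqrt 2"
    using fisher_rao_dist_diag_conj[OF MN, of l] unfolding R S s_exp .
  ultimately show ?thesis
    unfolding log[unfolded H_def] by (simp add: power_divide sum_nonneg)
qed

end
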